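(* Let $\varphi=\varphi(t)$ be the Kuranishi data of a holomorphic family $\pi:\mathfrak{X}\to\Delta$ of compact complex manifolds with central fiber $X_0$ and nearby fibers $X_t$ ($t$ small). For every $\omega\in A^{\star,\star}(X_0)$ (a smooth form of any pure type $(p,q)$), \begin{align*} d\big(e^{i_{\varphi}|i_{\overline{\varphi}}}(\omega)\big) =e^{i_{\varphi}|i_{\overline{\varphi}}}\Big(&\partial\omega+\big(\varphi\overline{\varphi}(\mathbf{1}-\varphi\overline{\varphi})^{-1}\big)\lrcorner\partial\omega-\partial\big(\big(\varphi\overline{\varphi}(\mathbf{1}-\varphi\overline{\varphi})^{-1}\big)\lrcorner\omega\big)+\big(\partial\big(\overline{\varphi}(\mathbf{1}-\varphi\overline{\varphi})^{-1}\big)\lrcorner\varphi\big)\lrcorner\omega\\ &-\big(\overline{\varphi}(\mathbf{1}-\varphi\overline{\varphi})^{-1}\big)\lrcorner\overline{\partial}\omega+\overline{\partial}\big(\big(\overline{\varphi}(\mathbf{1}-\varphi\overline{\varphi})^{-1}\big)\lrcorner\omega\big)-\big(\overline{\partial}(\mathbf{1}-\varphi\overline{\varphi})^{-1}\lrcorner\overline{\varphi}\big)\lrcorner\omega\\ &+\overline{\partial}\omega+\big(\overline{\varphi}\varphi(\mathbf{1}-\overline{\varphi}\varphi)^{-1}\big)\lrcorner\overline{\partial}\omega-\overline{\partial}\big(\big(\overline{\varphi}\varphi(\mathbf{1}-\overline{\varphi}\varphi)^{-1}\big)\lrcorner\omega\big)+\big(\overline{\partial}\big(\varphi(\mathbf{1}-\overline{\varphi}\varphi)^{-1}\big)\lrcorner\overline{\varphi}\big)\lrcorner\omega\\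 &-\big(\varphi(\mathbf{1}-\overline{\varphi}\varphi)^{-1}\big)\lrcorner\partial\omega+\partial\big(\big(\varphi(\mathbf{1}-\overline{\varphi}\varphi)^{-1}\big)\lrcorner\omega\big)-\big(\partial(\mathbf{1}-\overline{\varphi}\varphi)^{-1}\lrcorner\varphi\big)\lrcorner\omega\Big). \end{align*}
   Context: Setting. $\pi:\mathfrak{X}\to\Delta$ is a holomorphic family of $n$-dimensional compact complex manifolds over a small disk $\Delta\subset\mathbb{C}$, with central fiber $X_0$ and fibers $X_t=\pi^{-1}(t)$. A transversely holomorphic trivialization $\mathfrak{X}\cong X_0\times\Delta$ is fixed, by which $X_t$ is identified with $X_0$ as a smooth manifold. It yields the Kuranishi data $\varphi=\varphi(t)\in A^{0,1}(X_0,T^{1,0}_{X_0})$, depending holomorphically on $t$, with $\varphi(0)=0$ and $\overline{\partial}\varphi=\frac12[\varphi,\varphi]$, where for $\phi=\sum\phi^i\otimes\partial/\partial z^i$, $\psi=\sum\psi^i\otimes\partial/\partial z^i$ in $A^{0,1}(X_0,T^{1,0}_{X_0})$ one has $[\phi,\psi]=\sum_{i,j}(\phi^i\wedge\partial_i\psi^j+\psi^i\wedge\partial_i\phi^j)\otimes\partial/\partial z^j$. In local holomorphic coordinates $z$ on $X_0$, write $\varphi=\sum\varphi^i_{\bar k}\,d\bar z^k\otimes\partial/\partial z^i$; the forms $e^{i_\varphi}(dz^i)=dz^i+\varphi^i_{\bar k}d\bar z^k$ are a local frame of $T^{*(1,0)}_{X_t}$ and their conjugates a local frame of $T^{*(0,1)}_{X_t}$.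 $t$ is small enough that the inverses below exist. $A^{p,q}$ denotes smooth complex $(p,q)$-forms; $\partial,\overline{\partial}$ are those of $X_0$; $d$ is the exterior derivative. Contraction. For a vector-valued form $\eta\otimes v$ ($\eta$ a form, $v$ a complex vector field), $(\eta\otimes v)\lrcorner\alpha=\eta\wedge(v\lrcorner\alpha)$, extended linearly; $i_\varphi=\varphi\lrcorner$. If $\alpha$ is itself a vector-valued form, contraction acts on its form part. Exponentials. $e^{i_\varphi}=\sum_{k\ge0}\frac1{k!}i_\varphi^k$, and similarly $e^{i_{\overline{\varphi}}}$. The map $e^{i_{\varphi}|i_{\overline{\varphi}}}:A^{p,q}(X_0)\to A^{p,q}(X_t)$ sends $\omega=\sum\frac1{p!q!}\omega_{i_1\cdots i_p;j_1\cdots j_q}dz^{i_1}\wedge\cdots\wedge dz^{i_p}\wedge d\bar z^{j_1}\wedge\cdots\wedge d\bar z^{j_q}$ to $\sum\frac1{p!q!}\omega_{i_1\cdots i_p;j_1\cdots j_q}\,e^{i_\varphi}(dz^{i_1}\wedge\cdots\wedge dz^{i_p})\wedge e^{i_{\overline{\varphi}}}(d\bar z^{j_1}\wedge\cdots\wedge d\bar z^{j_q})$; it is extended additively to sums of forms of different types. Products. $\overline{\varphi}\varphi:=\varphi\lrcorner\overline{\varphi}=\sum\overline{\varphi}^{\bar i}_{k}\varphi^k_{\bar l}\,d\bar z^l\otimes\partial/\partial\bar z^i$ and $\varphi\overline{\varphi}:=\overline{\varphi}\lrcorner\varphi=\sum\varphi^i_{\bar k}\overline{\varphi}^{\bar k}_{l}\,dz^l\otimes\partial/\partial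 z^i$; that is, products are compositions of the corresponding bundle maps, $\mathbf{1}$ is the identity, and inverses are taken as endomorphisms. All such products (e.g. $\overline{\varphi}(\mathbf{1}-\varphi\overline{\varphi})^{-1}$) are regarded as vector-valued $1$-forms. $\partial$ and $\overline{\partial}$ act on vector-valued forms by acting on the coefficient forms with respect to $\partial/\partial z^i$ or $\partial/\partial\bar z^i$ in the cases occurring here. In $\overline{\partial}(\mathbf{1}-\varphi\overline{\varphi})^{-1}\lrcorner\overline{\varphi}$ the operator $\overline{\partial}$ is applied only to $(\mathbf{1}-\varphi\overline{\varphi})^{-1}$, and similarly for $\partial(\mathbf{1}-\overline{\varphi}\varphi)^{-1}\lrcorner\varphi$; likewise in $\partial(\overline{\varphi}(\mathbf{1}-\varphi\overline{\varphi})^{-1})\lrcorner\varphi$ and $\overline{\partial}(\varphi(\mathbf{1}-\overline{\varphi}\varphi)^{-1})\lrcorner\overline{\varphi}$ differentiation precedes the contraction into the last factor. *)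

theory Defs
  imports "HOL-Analysis.Analysis"
begin

section \<open>Complex manifolds\<close>

text \<open>
  A chart is a pair \<open>(U, c)\<close> of its domain and its coordinate map; the values of \<open>c\<close> outside
  \<open>U\<close> are irrelevant. Manifolds are subsets of a topological type and carry the subspace topology.
  The dimension is the cardinality of the index type \<open>'n\<close>.
\<close>

type_synonym ('a, 'n) chart = "'a set \<times> ('a \<Rightarrow> (complex, 'n) vec)"

definition chart_on :: "'a::topological_space set \<Rightarrow> ('a, 'n::finite) chart \<Rightarrow> bool" where
  "chart_on M = (\<lambda>(U, c). openin (top_of_set M) U \<and> open (c ` U) \<and>
     homeomorphism U (c ` U) c (inv_into U c))"

definition holo_on ::
    "(complex, 'm::finite) vec set \<Rightarrow> ((complex, 'm) vec \<Rightarrow> (complex, 'n::finite) vec) \<Rightarrow> bool" where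
  "holo_on S f \<longleftrightarrow>
     (\<forall>z\<in>S. \<exists>D. (f has_derivative D) (at z) \<and> (\<forall>a v. D (a *s v) = a *s D v))"

definition complex_manifold :: "'a::topological_space set \<Rightarrow> ('a, 'n::finite) chart set \<Rightarrow> bool" where
  "complex_manifold M A \<longleftrightarrow>
     (\<forall>C\<in>A. chart_on M C) \<and> (\<Union>(U, c)\<in>A. U) = M \<and>
     (\<forall>(U, c)\<in>A. \<forall>(V, d)\<in>A. holo_on (c ` (U \<inter> V)) (d \<circ> inv_into U c))"

primrec Ck_on :: "nat \<Rightarrow> 'v::real_normed_vector set \<Rightarrow> ('v \<Rightarrow> 'w::real_normed_vector) \<Rightarrow> bool" where
  "Ck_on 0 S f \<longleftrightarrow> continuous_on S f"
| "Ck_on (Suc k) S f \<longleftrightarrow>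
     (\<exists>f'. (\<forall>x\<in>S. (f has_derivative f' x) (at x)) \<and> (\<forall>v. Ck_on k S (\<lambda>x. f' x v)))"

text \<open>Only used for open \<open>S\<close> in finite-dimensional spaces.\<close>

definition smooth_on :: "'v::real_normed_vector set \<Rightarrow> ('v \<Rightarrow> 'w::real_normed_vector) \<Rightarrow> bool" where
  "smooth_on S f \<longleftrightarrow> (\<forall>k. Ck_on k S f)"


section \<open>Holomorphic families and their trivializations\<close>

text \<open>The base \<open>\<Delta>\<close> is the disk \<open>ball 0 r\<close>.\<close>

definition fiber :: "'a set \<Rightarrow> ('a \<Rightarrow> complex) \<Rightarrow> complex \<Rightarrow> 'a set" where
  "fiber X \<pi> t = {x \<in> X. \<pi> x = t}"

text \<open>
  A holomorphic family: a proper surjective holomorphic submersion from an \<open>(n+1)\<close>-dimensional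
  complex manifold.
\<close>

definition holomorphic_family ::
    "'a::topological_space set \<Rightarrow> ('a, 'n::finite option) chart set \<Rightarrow> ('a \<Rightarrow> complex) \<Rightarrow> real \<Rightarrow> bool" where
  "holomorphic_family X A \<pi> r \<longleftrightarrow>
     complex_manifold X A \<and> 0 < r \<and> \<pi> ` X = ball 0 r \<and>
     (\<forall>K. compact K \<and> K \<subseteq> ball 0 r \<longrightarrow> compact {x \<in> X. \<pi> x \<in> K}) \<and>
     (\<forall>(V, C)\<in>A. \<forall>w\<in>C ` V. \<exists>D. ((\<lambda>w. \<pi> (inv_into V C w)) has_derivative D) (at w) \<and>
        (\<forall>a v. D (a *s v) = a * D v) \<and> surj D)"

text \<open>
  The maximal atlas of the fibre as a complex submanifold: its charts are those whose inverses are
  holomorphic immersions into the total space.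
\<close>

definition fiber_atlas ::
    "'a::topological_space set \<Rightarrow> ('a, 'n::finite option) chart set \<Rightarrow> ('a \<Rightarrow> complex) \<Rightarrow> complex
      \<Rightarrow> ('a, 'n) chart set" where
  "fiber_atlas X A \<pi> t = {(U, c). chart_on (fiber X \<pi> t) (U, c) \<and>
     (\<forall>(V, C)\<in>A. holo_on (c ` (U \<inter> V)) (C \<circ> inv_into U c) \<and>
        (\<forall>z\<in>c ` (U \<inter> V). inj (frechet_derivative (C \<circ> inv_into U c) (at z))))}"

text \<open>
  The trivialization is the diffeomorphism \<open>y \<mapsto> (\<sigma> y, \<pi> y)\<close> from \<open>X\<close> to \<open>X\<^sub>0 \<times> \<Delta>\<close>, with
  inverse \<open>(x, t) \<mapsto> G x t\<close>. It is transversely holomorphic: \<open>G x\<close> is holomorphic in \<open>t\<close>.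
  The map \<open>\<lambda>x. G x t\<close> identifies \<open>X\<^sub>0\<close> with \<open>X\<^sub>t\<close>.
\<close>

definition transversely_holomorphic_trivialization ::
    "'a::topological_space set \<Rightarrow> ('a, 'n::finite option) chart set \<Rightarrow> ('a \<Rightarrow> complex) \<Rightarrow> real
      \<Rightarrow> ('a \<Rightarrow> 'a) \<Rightarrow> ('a \<Rightarrow> complex \<Rightarrow> 'a) \<Rightarrow> bool" where
  "transversely_holomorphic_trivialization X A \<pi> r \<sigma> G \<longleftrightarrow>
     homeomorphism X (fiber X \<pi> 0 \<times> ball 0 r) (\<lambda>y. (\<sigma> y, \<pi> y)) (\<lambda>(x, t). G x t) \<and>
     (\<forall>x\<in>fiber X \<pi> 0. G x 0 = x) \<and>
     (\<forall>(U, c)\<in>fiber_atlas X A \<pi> 0. \<forall>(V, C)\<in>A.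
        smooth_on {(z, t). z \<in> c ` U \<and> t \<in> ball 0 r \<and> G (inv_into U c z) t \<in> V}
          (\<lambda>(z, t). C (G (inv_into U c z) t)) \<and>
        smooth_on {w \<in> C ` V. \<sigma> (inv_into V C w) \<in> U} (\<lambda>w. c (\<sigma> (inv_into V C w)))) \<and>
     (\<forall>x\<in>fiber X \<pi> 0. \<forall>(V, C)\<in>A. \<forall>i.
        (\<lambda>t. C (G x t) $ i) holomorphic_on {t \<in> ball 0 r. G x t \<in> V})"


section \<open>Complex exterior algebra at a point\<close>

text \<open>
  The coordinate covectors are indexed by \<open>'n + 'n\<close>: \<open>Inl i\<close> stands for \<open>dz\<^sup>i\<close> and \<open>Inr i\<close> for its
  conjugate. A complex form at a point is the family of its coefficients: \<open>\<alpha> $ S\<close> is the coefficient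
  of the wedge product of the covectors in \<open>S\<close>, taken in increasing order, all \<open>Inl\<close> before all
  \<open>Inr\<close>. A vector-valued form is the family of its coefficient forms with respect to
  \<open>\<partial>/\<partial>z\<^sup>i\<close> (\<open>Inl i\<close>) and its conjugate (\<open>Inr i\<close>).
\<close>

type_synonym 'n form = "(complex, ('n + 'n) set) vec"
type_synonym 'n vform = "('n form, 'n + 'n) vec"

fun idx_less :: "'n::linorder + 'n \<Rightarrow> 'n + 'n \<Rightarrow> bool" where
  "idx_less (Inl i) (Inl j) \<longleftrightarrow> i < j"
| "idx_less (Inl i) (Inr j) \<longleftrightarrow> True"
| "idx_less (Inr i) (Inl j) \<longleftrightarrow> False"
| "idx_less (Inr i) (Inr j) \<longleftrightarrow> i < j"

definition inversions :: "('n::linorder + 'n) set \<Rightarrow> ('n + 'n) set \<Rightarrow> nat" where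
  "inversions S T = card {(a, b). a \<in> S \<and> b \<in> T \<and> idx_less b a}"

definition wedge :: "'n::{finite,linorder} form \<Rightarrow> 'n form \<Rightarrow> 'n form" (infixr "\<^bold>\<and>" 75) where
  "\<alpha> \<^bold>\<and> \<beta> = (\<chi> U. \<Sum>S\<in>Pow U. (-1) ^ inversions S (U - S) * \<alpha> $ S * \<beta> $ (U - S))"

definition one_form0 :: "'n::{finite,linorder} form" where
  "one_form0 = axis {} 1"

definition dx :: "'n::{finite,linorder} + 'n \<Rightarrow> 'n form" where
  "dx a = axis {a} 1"

definition wedge_family :: "('n \<Rightarrow> 'n form) \<Rightarrow> 'n::{finite,linorder} set \<Rightarrow> 'n form" where
  "wedge_family \<theta> I = foldr (\<lambda>i \<alpha>. \<theta> i \<^bold>\<and> \<alpha>) (sorted_list_of_set I) one_form0"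

definition interior :: "'n::{finite,linorder} + 'n \<Rightarrow> 'n form \<Rightarrow> 'n form" where
  "interior a \<alpha> = (\<chi> S. if a \<in> S then 0 else (-1) ^ inversions {a} S * \<alpha> $ insert a S)"

definition contr :: "'n::{finite,linorder} vform \<Rightarrow> 'n form \<Rightarrow> 'n form" (infixr "\<rightharpoondown>" 75) where
  "K \<rightharpoondown> \<alpha> = (\<Sum>a\<in>UNIV. K $ a \<^bold>\<and> interior a \<alpha>)"

definition vcontr :: "'n::{finite,linorder} vform \<Rightarrow> 'n vform \<Rightarrow> 'n vform" (infixr "\<rightharpoondown>\<^sub>v" 75) where
  "K \<rightharpoondown>\<^sub>v L = (\<chi> a. K \<rightharpoondown> (L $ a))"

definition exp_contr :: "'n::{finite,linorder} vform \<Rightarrow> 'n form \<Rightarrow> 'n form" where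
  "exp_contr K \<alpha> = (\<Sum>k. (1 / fact k) *\<^sub>R ((contr K) ^^ k) \<alpha>)"

definition has_type :: "nat \<Rightarrow> nat \<Rightarrow> 'n::{finite,linorder} form \<Rightarrow> bool" where
  "has_type p q \<alpha> \<longleftrightarrow>
     (\<forall>S. \<alpha> $ S \<noteq> 0 \<longrightarrow> card {i. Inl i \<in> S} = p \<and> card {j. Inr j \<in> S} = q)"

text \<open>Pullback along a holomorphic map with Jacobian \<open>J $ a $ i = \<partial>\<tau>\<^sup>a/\<partial>z\<^sup>i\<close>.\<close>

definition pullback ::
    "((complex, 'n) vec, 'n) vec \<Rightarrow> 'n::{finite,linorder} form \<Rightarrow> 'n form" where
  "pullback J \<alpha> = (\<Sum>S\<in>UNIV. \<alpha> $ S *s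
     (wedge_family (\<lambda>a. \<Sum>i\<in>UNIV. J $ a $ i *s dx (Inl i)) {i. Inl i \<in> S} \<^bold>\<and>
      wedge_family (\<lambda>a. \<Sum>i\<in>UNIV. cnj (J $ a $ i) *s dx (Inr i)) {j. Inr j \<in> S}))"


section \<open>Differential operators in a chart\<close>

definition dir_deriv ::
    "((complex, 'n::finite) vec \<Rightarrow> 'w::real_normed_vector) \<Rightarrow> (complex, 'n) vec \<Rightarrow> (complex, 'n) vec \<Rightarrow> 'w" where
  "dir_deriv f z v = frechet_derivative f (at z) v"

text \<open>With \<open>z\<^sup>i = x\<^sup>i + \<i> y\<^sup>i\<close>, the directions of \<open>x\<^sup>i\<close> and \<open>y\<^sup>i\<close> are \<open>axis i 1\<close> and \<open>axis i \<i>\<close>.\<close>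

definition ext_d :: "((complex, 'n) vec \<Rightarrow> 'n form) \<Rightarrow> (complex, 'n::{finite,linorder}) vec \<Rightarrow> 'n form" where
  "ext_d \<alpha> z = (\<Sum>i\<in>UNIV.
     ((1 / 2) *s (dx (Inl i) + dx (Inr i))) \<^bold>\<and> dir_deriv \<alpha> z (axis i 1) +
     ((1 / (2 * \<i>)) *s (dx (Inl i) - dx (Inr i))) \<^bold>\<and> dir_deriv \<alpha> z (axis i \<i>))"

fun wirtinger ::
    "'n + 'n \<Rightarrow> ((complex, 'n) vec \<Rightarrow> 'n form) \<Rightarrow> (complex, 'n::{finite,linorder}) vec \<Rightarrow> 'n form" where
  "wirtinger (Inl i) \<alpha> z = (1 / 2) *s (dir_deriv \<alpha> z (axis i 1) - \<i> *s dir_deriv \<alpha> z (axis i \<i>))"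
| "wirtinger (Inr i) \<alpha> z = (1 / 2) *s (dir_deriv \<alpha> z (axis i 1) + \<i> *s dir_deriv \<alpha> z (axis i \<i>))"

definition del :: "((complex, 'n) vec \<Rightarrow> 'n form) \<Rightarrow> (complex, 'n::{finite,linorder}) vec \<Rightarrow> 'n form" where
  "del \<alpha> z = (\<Sum>i\<in>UNIV. dx (Inl i) \<^bold>\<and> wirtinger (Inl i) \<alpha> z)"

definition delbar :: "((complex, 'n) vec \<Rightarrow> 'n form) \<Rightarrow> (complex, 'n::{finite,linorder}) vec \<Rightarrow> 'n form" where
  "delbar \<alpha> z = (\<Sum>i\<in>UNIV. dx (Inr i) \<^bold>\<and> wirtinger (Inr i) \<alpha> z)"

definition vdel :: "((complex, 'n) vec \<Rightarrow> 'n vform) \<Rightarrow> (complex, 'n::{finite,linorder}) vec \<Rightarrow> 'n vform" where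
  "vdel K z = (\<chi> a. del (\<lambda>y. K y $ a) z)"

definition vdelbar :: "((complex, 'n) vec \<Rightarrow> 'n vform) \<Rightarrow> (complex, 'n::{finite,linorder}) vec \<Rightarrow> 'n vform" where
  "vdelbar K z = (\<chi> a. delbar (\<lambda>y. K y $ a) z)"

definition bracket ::
    "((complex, 'n) vec \<Rightarrow> 'n vform) \<Rightarrow> ((complex, 'n) vec \<Rightarrow> 'n vform)
      \<Rightarrow> (complex, 'n::{finite,linorder}) vec \<Rightarrow> 'n vform" where
  "bracket K L z = (\<chi> b. case b of
     Inl j \<Rightarrow> \<Sum>i\<in>UNIV. K z $ Inl i \<^bold>\<and> wirtinger (Inl i) (\<lambda>y. L y $ Inl j) z
                       + L z $ Inl i \<^bold>\<and> wirtinger (Inl i) (\<lambda>y. K y $ Inl j) z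
   | Inr j \<Rightarrow> 0)"


section \<open>Bundle maps as vector-valued 1-forms\<close>

text \<open>
  A matrix \<open>M\<close> represents a bundle map between \<open>T\<^sup>1\<^sup>,\<^sup>0\<close> and \<open>T\<^sup>0\<^sup>,\<^sup>1\<close> in the coordinate frames. The
  arguments \<open>u\<close> and \<open>s\<close>, each \<open>Inl\<close> (for \<open>T\<^sup>1\<^sup>,\<^sup>0\<close>) or \<open>Inr\<close> (for \<open>T\<^sup>0\<^sup>,\<^sup>1\<close>), name target and source.
\<close>

definition map_form ::
    "('n \<Rightarrow> 'n + 'n) \<Rightarrow> ('n \<Rightarrow> 'n + 'n) \<Rightarrow> ((complex, 'n) vec, 'n) vec \<Rightarrow> 'n::{finite,linorder} vform" where
  "map_form u s M = (\<chi> a. \<Sum>i\<in>UNIV. if a = u i then \<Sum>l\<in>UNIV. M $ i $ l *s dx (s l) else 0)"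

definition cnj_mat :: "((complex, 'n) vec, 'n::finite) vec \<Rightarrow> ((complex, 'n) vec, 'n) vec" where
  "cnj_mat M = (\<chi> i j. cnj (M $ i $ j))"

text \<open>The matrix of \<open>\<phi>\<close> has the entries \<open>\<phi>\<^sup>i\<^sub>k\<close> (row \<open>i\<close>, column \<open>k\<close>).\<close>

definition phi_form :: "((complex, 'n) vec, 'n) vec \<Rightarrow> 'n::{finite,linorder} vform" where
  "phi_form P = map_form Inl Inr P"

definition phibar_form :: "((complex, 'n) vec, 'n) vec \<Rightarrow> 'n::{finite,linorder} vform" where
  "phibar_form P = map_form Inr Inl (cnj_mat P)"

text \<open>
  The map \<open>exp(i\<^sub>\<phi> | i\<^sub>\<psi>)\<close> with \<open>\<psi>\<close> the conjugate of \<open>\<phi>\<close>: the first exponential acts on the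
  \<open>dz\<close>-part of each basis form, the second one on its conjugate part.
\<close>

definition exp_pair :: "((complex, 'n) vec, 'n) vec \<Rightarrow> 'n::{finite,linorder} form \<Rightarrow> 'n form" where
  "exp_pair P \<alpha> = (\<Sum>S\<in>UNIV. \<alpha> $ S *s
     (exp_contr (phi_form P) (wedge_family (\<lambda>i. dx (Inl i)) {i. Inl i \<in> S}) \<^bold>\<and>
      exp_contr (phibar_form P) (wedge_family (\<lambda>j. dx (Inr j)) {j. Inr j \<in> S})))"


section \<open>Global tensor fields\<close>

text \<open>
  A form on a complex manifold is a family of local expressions, one for each chart of the given
  atlas, which are related by pullback along the coordinate changes; only the values on the images
  of the charts matter. Sections of \<open>A\<^sup>0\<^sup>,\<^sup>1(T\<^sup>1\<^sup>,\<^sup>0)\<close> are treated in the same way.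
\<close>

definition jacobian ::
    "((complex, 'n) vec \<Rightarrow> (complex, 'n) vec) \<Rightarrow> (complex, 'n::finite) vec \<Rightarrow> ((complex, 'n) vec, 'n) vec" where
  "jacobian \<tau> z = matrix (frechet_derivative \<tau> (at z))"

definition pq_form ::
    "('a, 'n) chart set \<Rightarrow> nat \<Rightarrow> nat \<Rightarrow>
      (('a, 'n) chart \<Rightarrow> (complex, 'n) vec \<Rightarrow> 'n::{finite,linorder} form) \<Rightarrow> bool" where
  "pq_form A p q \<omega> \<longleftrightarrow>
     (\<forall>(U, c)\<in>A. smooth_on (c ` U) (\<omega> (U, c)) \<and> (\<forall>z\<in>c ` U. has_type p q (\<omega> (U, c) z))) \<and>
     (\<forall>(U, c)\<in>A. \<forall>(V, d)\<in>A. \<forall>z\<in>c ` (U \<inter> V).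
        \<omega> (U, c) z = pullback (jacobian (d \<circ> inv_into U c) z) (\<omega> (V, d) (d (inv_into U c z))))"

definition beltrami_field ::
    "('a, 'n) chart set \<Rightarrow>
      (('a, 'n) chart \<Rightarrow> (complex, 'n) vec \<Rightarrow> ((complex, 'n) vec, 'n::{finite,linorder}) vec) \<Rightarrow> bool" where
  "beltrami_field A \<psi> \<longleftrightarrow>
     (\<forall>(U, c)\<in>A. smooth_on (c ` U) (\<psi> (U, c))) \<and>
     (\<forall>(U, c)\<in>A. \<forall>(V, d)\<in>A. \<forall>z\<in>c ` (U \<inter> V).
        \<psi> (V, d) (d (inv_into U c z)) ** cnj_mat (jacobian (d \<circ> inv_into U c) z) =
        jacobian (d \<circ> inv_into U c) z ** \<psi> (U, c) z)"

text \<open>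
  The last condition says that the forms \<open>exp(i\<^sub>\<phi>) dz\<^sup>i\<close> are a frame of the pullback to \<open>X\<^sub>0\<close> of the
  \<open>(1,0)\<close>-cotangent bundle of \<open>X\<^sub>t\<close>, which is spanned by the differentials of holomorphic coordinates
  of \<open>X\<^sub>t\<close>. They are automatically linearly independent, and conjugation gives the
  corresponding statement for the \<open>(0,1)\<close>-cotangent bundle.
\<close>

definition kuranishi_data ::
    "'a::topological_space set \<Rightarrow> ('a, 'n::{finite,linorder} option) chart set \<Rightarrow> ('a \<Rightarrow> complex) \<Rightarrow> real
      \<Rightarrow> ('a \<Rightarrow> complex \<Rightarrow> 'a)
      \<Rightarrow> (complex \<Rightarrow> ('a, 'n) chart \<Rightarrow> (complex, 'n) vec \<Rightarrow> ((complex, 'n) vec, 'n) vec) \<Rightarrow> bool" where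
  "kuranishi_data X A \<pi> r G \<phi> \<longleftrightarrow>
     (\<forall>t\<in>ball 0 r. beltrami_field (fiber_atlas X A \<pi> 0) (\<phi> t)) \<and>
     (\<forall>(U, c)\<in>fiber_atlas X A \<pi> 0. \<forall>z\<in>c ` U.
        \<phi> 0 (U, c) z = 0 \<and>
        (\<forall>i k. (\<lambda>t. \<phi> t (U, c) z $ i $ k) holomorphic_on ball 0 r)) \<and>
     (\<forall>t\<in>ball 0 r. \<forall>(U, c)\<in>fiber_atlas X A \<pi> 0. \<forall>z\<in>c ` U.
        vdelbar (\<lambda>y. phi_form (\<phi> t (U, c) y)) z =
        (1 / 2) *\<^sub>R bracket (\<lambda>y. phi_form (\<phi> t (U, c) y)) (\<lambda>y. phi_form (\<phi> t (U, c) y)) z) \<and>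
     (\<forall>t\<in>ball 0 r. \<forall>(U, c)\<in>fiber_atlas X A \<pi> 0. \<forall>(W, w)\<in>fiber_atlas X A \<pi> t.
        \<forall>z\<in>c ` U. G (inv_into U c z) t \<in> W \<longrightarrow>
          vec.span (range (\<lambda>i. exp_contr (phi_form (\<phi> t (U, c) z)) (dx (Inl i)))) =
          vec.span (range (\<lambda>a. ext_d (\<lambda>y. (w (G (inv_into U c y) t) $ a) *s one_form0) z)))"

end

(* The map exp(i_phi | i_phibar) is an algebra homomorphism E of the exterior algebra, so E^-1 d E is
   a derivation of degree 1. Each contraction by a vector-valued 1-form is a derivation of degree 0, so
   its commutators with the two Dolbeault operators, and the contractions by vector-valued 2-forms, are
   derivations of degree 1 as well. It thus suffices to compare both sides on functions and on the
   covectors dz^i and their conjugates. On functions this is the inversion of the block matrix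
   (1, phi; phibar, 1). On dz^i the Maurer-Cartan equation turns d(phi^i) into the sum over j of
   E(dz^j) /\ (d/dz^j) phi^i; on the conjugate covectors one uses the conjugate equation.

   Everything is carried out at one point: each side is the sum over a of theta_a /\ (d/dx^a) omega
   plus a zeroth-order derivation, and only these coefficients are compared. The arguments u, v stand
   for Inl, Inr or Inr, Inl, so that each computation is done once for both conjugate halves. *)

theory Submission
  imports Defs
begin

section \<open>The exterior algebra\<close>

text \<open>E is never inverted. The coefficients of E^-1 d E are guessed, as covectors \<theta>_a
  and 2-forms L_a, and only E(\<theta>_a) = dx_a and E(L_a) = d(E(dx_a)) are verified. With P and Q
  the matrices of \<phi> and its conjugate, R = (1 - PQ)^-1 and R' = (1 - QP)^-1, the guess comes
  from the inverse (R, -PR'; -QR, R') of the block matrix; the factor PQR of the formula is R - 1.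

  The zeroth-order terms look worse, since they differentiate R and R'. But contracting a derivative
  into \<phi> multiplies it by P from the left, and the differences d(PQR) - P d(QR) and d(PR') - P
  d(R') leave only the derivative of P. The derivative of an inverse matrix is therefore never
  computed; its existence suffices.

  The main obstacle is the encoding. Forms are coefficient families on sorted index sets, and
  \<open>exp_pair\<close> is prescribed on sorted monomials with separate exponentials on the two
  blocks, so its compatibility with products has to be extracted from a count of inversions.\<close>

lemma idx_less_irrefl [simp]: "\<not> idx_less a a"
  by (cases a) auto

lemma idx_less_linear: "a \<noteq> b \<Longrightarrow> idx_less a b \<longleftrightarrow> \<not> idx_less b a"
  by (cases a; cases b) auto

lemma idx_less_trans: "idx_less a b \<Longrightarrow> idx_less b c \<Longrightarrow> idx_less a c"
  by (cases a; cases b; cases c) auto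

lemma inversions_Un_right:
  fixes S T W :: "('n::{finite,linorder} + 'n) set"
  assumes "T \<inter> W = {}"
  shows "inversions S (T \<union> W) = inversions S T + inversions S W"
proof -
  have "{(a, b). a \<in> S \<and> b \<in> T \<union> W \<and> idx_less b a} =
    {(a, b). a \<in> S \<and> b \<in> T \<and> idx_less b a} \<union> {(a, b). a \<in> S \<and> b \<in> W \<and> idx_less b a}"
    by auto
  moreover have "{(a, b). a \<in> S \<and> b \<in> T \<and> idx_less b a} \<inter> {(a, b). a \<in> S \<and> b \<in> W \<and> idx_less b a} = {}"
    using assms by auto
  ultimately show ?thesis
    unfolding inversions_def by (simp add: card_Un_disjoint)
qed

lemma inversions_Un_left:
  fixes S T W :: "('n::{finite,linorder} + 'n) set"
  assumes "S \<inter> T = {}"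
  shows "inversions (S \<union> T) W = inversions S W + inversions T W"
proof -
  have "{(a, b). a \<in> S \<union> T \<and> b \<in> W \<and> idx_less b a} =
    {(a, b). a \<in> S \<and> b \<in> W \<and> idx_less b a} \<union> {(a, b). a \<in> T \<and> b \<in> W \<and> idx_less b a}"
    by auto
  moreover have "{(a, b). a \<in> S \<and> b \<in> W \<and> idx_less b a} \<inter> {(a, b). a \<in> T \<and> b \<in> W \<and> idx_less b a} = {}"
    using assms by auto
  ultimately show ?thesis
    unfolding inversions_def by (simp add: card_Un_disjoint)
qed

lemma inversions_singletons: "inversions {a} {b} = (if idx_less b a then 1 else 0)"
proof -
  have "{(x, y). x \<in> {a} \<and> y \<in> {b} \<and> idx_less y x} = (if idx_less b a then {(a, b)} else {})"
    by auto
  then show ?thesis unfolding inversions_def by simp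
qed

lemma inversions_empty [simp]: "inversions {} S = 0" "inversions S {} = 0"
  by (simp_all add: inversions_def)

lemma inversions_insert_right:
  fixes S :: "('n::{finite,linorder} + 'n) set"
  assumes "b \<notin> S"
  shows "inversions {a} (insert b S) = inversions {a} S + (if idx_less b a then 1 else 0)"
  using inversions_Un_right[of "S" "{b}" "{a}"] assms by (simp add: inversions_singletons)

text \<open>Both sides sum over the ways to split U into three ordered blocks, and for either
  bracketing the sign exponent counts the inversions between the three pairs of blocks.\<close>

lemma wedge_assoc:
  fixes \<alpha> \<beta> \<gamma> :: "'n::{finite,linorder} form"
  shows "(\<alpha> \<^bold>\<and> \<beta>) \<^bold>\<and> \<gamma> = \<alpha> \<^bold>\<and> (\<beta> \<^bold>\<and> \<gamma>)"
proof (rule vec_eq_iff[THEN iffD2], rule allI)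
  fix U :: "('n + 'n) set"
  have "((\<alpha> \<^bold>\<and> \<beta>) \<^bold>\<and> \<gamma>) $ U = (\<Sum>(V, S)\<in>Sigma (Pow U) Pow.
      (-1) ^ inversions V (U - V) * ((-1) ^ inversions S (V - S) * \<alpha> $ S * \<beta> $ (V - S)) * \<gamma> $ (U - V))"
    by (simp add: wedge_def sum_distrib_left sum_distrib_right sum.Sigma)
  also have "\<dots> = (\<Sum>(S, T)\<in>Sigma (Pow U) (\<lambda>S. Pow (U - S)).
      (-1) ^ inversions S (U - S) * \<alpha> $ S * ((-1) ^ inversions T (U - S - T) * \<beta> $ T * \<gamma> $ (U - S - T)))"
  proof (rule sum.reindex_bij_witness[where i = "\<lambda>(S, T). (S \<union> T, S)" and j = "\<lambda>(V, S). (S, V - S)"], goal_cases)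
    \<comment> \<open>The other four obligations are set identities; the fifth compares the summands
      and their signs.\<close>
    case (5 p)
    obtain V S where p: "p = (V, S)" "V \<subseteq> U" "S \<subseteq> V" using 5 by auto
    have "inversions V (U - V) = inversions S (U - V) + inversions (V - S) (U - V)"
      using inversions_Un_left[of S "V - S" "U - V"] p by (simp add: Un_absorb1)
    moreover have "(V - S) \<union> (U - V) = U - S" using p by auto
    then have "inversions S (U - S) = inversions S (V - S) + inversions S (U - V)"
      using inversions_Un_right[of "V - S" "U - V" S] by auto
    moreover have "U - S - (V - S) = U - V" using p by auto
    ultimately show ?case using p by (simp add: power_add mult_ac)
  qed auto
  also have "\<dots> = (\<alpha> \<^bold>\<and> (\<beta> \<^bold>\<and> \<gamma>)) $ U"
    by (simp add: wedge_def sum_distrib_left sum.Sigma)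
  finally show "((\<alpha> \<^bold>\<and> \<beta>) \<^bold>\<and> \<gamma>) $ U = (\<alpha> \<^bold>\<and> (\<beta> \<^bold>\<and> \<gamma>)) $ U" .
qed

lemma wedge_add_left: "(\<alpha> + \<beta>) \<^bold>\<and> \<gamma> = \<alpha> \<^bold>\<and> \<gamma> + \<beta> \<^bold>\<and> \<gamma>"
  by (simp add: wedge_def vec_eq_iff algebra_simps sum.distrib)

lemma wedge_add_right: "\<alpha> \<^bold>\<and> (\<beta> + \<gamma>) = \<alpha> \<^bold>\<and> \<beta> + \<alpha> \<^bold>\<and> \<gamma>"
  by (simp add: wedge_def vec_eq_iff algebra_simps sum.distrib)

lemma wedge_smult_left: "(c *s \<alpha>) \<^bold>\<and> \<beta> = c *s (\<alpha> \<^bold>\<and> \<beta>)"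
  by (simp add: wedge_def vec_eq_iff sum_distrib_left mult_ac)

lemma wedge_smult_right: "\<alpha> \<^bold>\<and> (c *s \<beta>) = c *s (\<alpha> \<^bold>\<and> \<beta>)"
  by (simp add: wedge_def vec_eq_iff sum_distrib_left mult_ac)

lemma wedge_zero [simp]: "0 \<^bold>\<and> \<alpha> = 0" "\<alpha> \<^bold>\<and> 0 = 0"
  by (simp_all add: wedge_def vec_eq_iff)

lemma wedge_minus_left: "(- \<alpha>) \<^bold>\<and> \<beta> = - (\<alpha> \<^bold>\<and> \<beta>)"
  using wedge_smult_left[of "-1" \<alpha> \<beta>] by simp

lemma wedge_minus_right: "\<alpha> \<^bold>\<and> (- \<beta>) = - (\<alpha> \<^bold>\<and> \<beta>)"
  using wedge_smult_right[of \<alpha> "-1" \<beta>] by simp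

lemma wedge_diff_left: "(\<alpha> - \<beta>) \<^bold>\<and> \<gamma> = \<alpha> \<^bold>\<and> \<gamma> - \<beta> \<^bold>\<and> \<gamma>"
  using wedge_add_left[of \<alpha> "- \<beta>" \<gamma>] by (simp add: wedge_minus_left)

lemma wedge_diff_right: "\<alpha> \<^bold>\<and> (\<beta> - \<gamma>) = \<alpha> \<^bold>\<and> \<beta> - \<alpha> \<^bold>\<and> \<gamma>"
  using wedge_add_right[of \<alpha> \<beta> "- \<gamma>"] by (simp add: wedge_minus_right)

lemma wedge_sum_left: "(\<Sum>i\<in>I. f i) \<^bold>\<and> \<beta> = (\<Sum>i\<in>I. f i \<^bold>\<and> \<beta>)"
  by (induction I rule: infinite_finite_induct) (auto simp: wedge_add_left)

lemma wedge_sum_right: "\<alpha> \<^bold>\<and> (\<Sum>i\<in>I. f i) = (\<Sum>i\<in>I. \<alpha> \<^bold>\<and> f i)"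
  by (induction I rule: infinite_finite_induct) (auto simp: wedge_add_right)

lemmas wedge_linear =
  wedge_add_left wedge_add_right wedge_smult_left wedge_smult_right wedge_minus_left
  wedge_minus_right wedge_diff_left wedge_diff_right wedge_sum_left wedge_sum_right

lemma scaleR_form: "c *\<^sub>R \<alpha> = of_real c *s (\<alpha> :: (complex, 'b::finite) vec)"
  by (simp add: vec_eq_iff scaleR_conv_of_real[where 'a = complex])

lemma bounded_bilinear_wedge: "bounded_bilinear (wedge :: 'n::{finite,linorder} form \<Rightarrow> _)"
proof -
  have "bilinear (wedge :: 'n form \<Rightarrow> _)"
    unfolding bilinear_def by (auto intro!: linearI simp: wedge_linear scaleR_form)
  then show ?thesis by (simp add: bilinear_conv_bounded_bilinear)
qed

lemma one_form0_wedge [simp]: "one_form0 \<^bold>\<and> \<alpha> = \<alpha>"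
proof (rule vec_eq_iff[THEN iffD2], rule allI)
  fix U
  have "(one_form0 \<^bold>\<and> \<alpha>) $ U = (\<Sum>S\<in>Pow U. if S = {} then \<alpha> $ U else 0)"
    unfolding wedge_def one_form0_def vec_lambda_beta by (rule sum.cong) (auto simp: axis_def)
  then show "(one_form0 \<^bold>\<and> \<alpha>) $ U = \<alpha> $ U" by simp
qed

lemma wedge_one_form0 [simp]: "\<alpha> \<^bold>\<and> one_form0 = \<alpha>"
proof (rule vec_eq_iff[THEN iffD2], rule allI)
  fix U
  have "(\<alpha> \<^bold>\<and> one_form0) $ U = (\<Sum>S\<in>Pow U. if S = U then \<alpha> $ U else 0)"
    unfolding wedge_def one_form0_def vec_lambda_beta by (rule sum.cong) (auto simp: axis_def)
  then show "(\<alpha> \<^bold>\<and> one_form0) $ U = \<alpha> $ U" by simp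
qed

section \<open>Basis monomials and induction on them\<close>

lemma dx_wedge_nth:
  "(dx a \<^bold>\<and> \<alpha>) $ U = (if a \<in> U then (-1) ^ inversions {a} (U - {a}) * \<alpha> $ (U - {a}) else 0)"
proof -
  have "(dx a \<^bold>\<and> \<alpha>) $ U =
      (\<Sum>S\<in>Pow U. if S = {a} then (-1) ^ inversions {a} (U - {a}) * \<alpha> $ (U - {a}) else 0)"
    unfolding wedge_def dx_def vec_lambda_beta by (rule sum.cong) (auto simp: axis_def)
  then show ?thesis by simp
qed

lemma dx_wedge_axis:
  fixes S :: "('n::{finite,linorder} + 'n) set"
  assumes "a \<notin> S"
  shows "dx a \<^bold>\<and> axis S 1 = (-1) ^ inversions {a} S *s axis (insert a S) 1"
  using assms by (auto simp: vec_eq_iff dx_wedge_nth axis_def)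

lemma dx_wedge_axis_in: "a \<in> S \<Longrightarrow> dx a \<^bold>\<and> axis S 1 = 0"
  by (auto simp: vec_eq_iff dx_wedge_nth axis_def)

lemma inversions_min:
  fixes S :: "('n::{finite,linorder} + 'n) set"
  assumes "\<forall>b\<in>S. idx_less a b"
  shows "inversions {a} S = 0"
proof -
  have "\<not> idx_less b a" if "b \<in> S" for b
    using assms that idx_less_trans idx_less_irrefl by blast
  then have "inversions {a} S = card ({} :: (('n + 'n) \<times> ('n + 'n)) set)"
    unfolding inversions_def by (intro arg_cong[where f = card]) auto
  then show ?thesis by simp
qed

lemma axis_insert_min:
  fixes S :: "('n::{finite,linorder} + 'n) set"
  assumes "\<forall>b\<in>S. idx_less a b"
  shows "axis (insert a S) 1 = dx a \<^bold>\<and> axis S 1"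
proof -
  have "a \<notin> S" using assms by auto
  then show ?thesis by (simp add: dx_wedge_axis inversions_min[OF assms])
qed

text \<open>Sets are built by adding an element below all others, since left multiplication by its
  covector then produces the larger basis monomial without a sign.\<close>

lemma idx_min_induct [case_names empty insert]:
  fixes S :: "('n::{finite,linorder} + 'n) set"
  assumes "Q {}" and step: "\<And>a S. \<forall>b\<in>S. idx_less a b \<Longrightarrow> Q S \<Longrightarrow> Q (insert a S)"
  shows "Q S"
proof (induction "card S" arbitrary: S)
  case 0
  then show ?case using assms by simp
next
  case (Suc k)
  let ?L = "{i. Inl i \<in> S}" and ?R = "{i. Inr i \<in> S}"
  have ne: "S \<noteq> {}" using Suc by auto
  \<comment> \<open>All \<open>Inl\<close> indices precede the \<open>Inr\<close> ones, so the least
    element is the least \<open>Inl\<close> index if there is one and otherwise the least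
    \<open>Inr\<close> index.\<close>
  obtain a where a: "a \<in> S" "\<forall>b\<in>S - {a}. idx_less a b"
  proof (cases "?L = {}")
    case False
    then have "Min ?L \<in> ?L" by (intro Min_in) auto
    moreover have "idx_less (Inl (Min ?L)) b" if "b \<in> S - {Inl (Min ?L)}" for b
      using that by (cases b) (auto simp: order_less_le)
    ultimately show thesis using that by blast
  next
    case True
    have "?R \<noteq> {}" using ne True by (metis (mono_tags) Collect_empty_eq all_not_in_conv sum.exhaust)
    then have "Min ?R \<in> ?R" by (intro Min_in) auto
    moreover have "idx_less (Inr (Min ?R)) b" if "b \<in> S - {Inr (Min ?R)}" for b
      using that True by (cases b) (auto simp: order_less_le)
    ultimately show thesis using that by blast
  qed
  have "Q (S - {a})" using Suc a by simp
  then have "Q (insert a (S - {a}))" using a step by blast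
  then show ?case using a by (simp add: insert_absorb)
qed

text \<open>The unit and left multiplication by the \<open>dx a\<close> generate the exterior
  algebra. Asking for inheritance under multiplication, rather than for agreement on generators,
  lets homomorphisms and derivations along homomorphisms be compared by the same rule.\<close>

lemma linear_form_eqI:
  fixes F G :: "'n::{finite,linorder} form \<Rightarrow> 'n form"
  assumes F: "\<And>\<alpha> \<beta>. F (\<alpha> + \<beta>) = F \<alpha> + F \<beta>" "\<And>c \<alpha>. F (c *s \<alpha>) = c *s F \<alpha>"
    and G: "\<And>\<alpha> \<beta>. G (\<alpha> + \<beta>) = G \<alpha> + G \<beta>" "\<And>c \<alpha>. G (c *s \<alpha>) = c *s G \<alpha>"
    and one: "F one_form0 = G one_form0"
    and step: "\<And>a \<beta>. F \<beta> = G \<beta> \<Longrightarrow> F (dx a \<^bold>\<and> \<beta>) = G (dx a \<^bold>\<and> \<beta>)"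
  shows "F \<alpha> = G \<alpha>"
proof -
  have *: "F (axis S 1) = G (axis S 1)" for S
    by (induction S rule: idx_min_induct)
      (use one step in \<open>auto simp: one_form0_def axis_insert_min\<close>)
  have "F 0 = 0" "G 0 = 0" using F(2)[of 0 0] G(2)[of 0 0] by auto
  then have "F (\<Sum>S\<in>\<S>. \<alpha> $ S *s axis S 1) = G (\<Sum>S\<in>\<S>. \<alpha> $ S *s axis S 1)" for \<S> :: "('n + 'n) set set"
    by (induction \<S> rule: infinite_finite_induct) (simp_all add: F G *)
  from this[of UNIV] show ?thesis by (simp add: basis_expansion)
qed

lemma dx_anticommute: "dx a \<^bold>\<and> dx b = - (dx b \<^bold>\<and> dx a)"
proof (cases "a = b")
  case True
  then show ?thesis using dx_wedge_axis_in[of a "{a}"] by (simp add: dx_def)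
next
  case False
  then show ?thesis using dx_wedge_axis[of a "{b}"] dx_wedge_axis[of b "{a}"] idx_less_linear[OF False]
    by (auto simp: inversions_singletons insert_commute dx_def[symmetric] vec_eq_iff)
qed

abbreviation covectors :: "'n::{finite,linorder} form set" where
  "covectors \<equiv> vec.span (range dx)"

lemma dx_covector [simp]: "dx a \<in> covectors"
  by (simp add: vec.span_base)

lemma covector_anticommute:
  assumes "\<eta> \<in> covectors" "\<xi> \<in> covectors"
  shows "\<eta> \<^bold>\<and> \<xi> = - (\<xi> \<^bold>\<and> \<eta>)"
proof -
  have 1: "dx a \<^bold>\<and> \<xi> = - (\<xi> \<^bold>\<and> dx a)" for a
    using assms(2)
    by (induction rule: vec.span_induct_alt) (auto simp: wedge_linear dx_anticommute[of a])
  show ?thesis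
    using assms(1)
    by (induction rule: vec.span_induct_alt) (auto simp: wedge_linear 1)
qed

lemma covector_left_anticommute:
  assumes "\<eta> \<in> covectors" "\<xi> \<in> covectors"
  shows "\<eta> \<^bold>\<and> (\<xi> \<^bold>\<and> \<beta>) = - (\<xi> \<^bold>\<and> (\<eta> \<^bold>\<and> \<beta>))"
  using covector_anticommute[OF assms] by (metis wedge_assoc wedge_minus_left)

lemma covector_square:
  assumes "\<eta> \<in> covectors"
  shows "\<eta> \<^bold>\<and> (\<eta> \<^bold>\<and> \<beta>) = 0"
  using covector_left_anticommute[OF assms assms, of \<beta>] by (simp add: vec_eq_iff)

section \<open>Interior products\<close>

lemma interior_add: "interior a (\<alpha> + \<beta>) = interior a \<alpha> + interior a \<beta>"
  by (simp add: interior_def vec_eq_iff algebra_simps)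

lemma interior_smult: "interior a (c *s \<alpha>) = c *s interior a \<alpha>"
  by (simp add: interior_def vec_eq_iff algebra_simps)

lemma interior_one_form0 [simp]: "interior a one_form0 = 0"
  by (simp add: interior_def vec_eq_iff one_form0_def axis_def)

text \<open>For a \<noteq> b this is a sign count: exchanging the two operations changes exactly one
  of the two inversion counts by one, because exactly one of \<open>idx_less a b\<close> and
  \<open>idx_less b a\<close> holds.\<close>

lemma interior_dx_wedge:
  fixes \<beta> :: "'n::{finite,linorder} form"
  shows "interior b (dx a \<^bold>\<and> \<beta>) = (if a = b then \<beta> else 0) - dx a \<^bold>\<and> interior b \<beta>"
proof (rule vec_eq_iff[THEN iffD2], rule allI)
  fix S :: "('n + 'n) set"
  show "interior b (dx a \<^bold>\<and> \<beta>) $ S = ((if a = b then \<beta> else 0) - dx a \<^bold>\<and> interior b \<beta>) $ S"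
  proof (cases "a = b")
    case True
    have "insert b (S - {b}) = S" if "b \<in> S" using that by auto
    then show ?thesis using True
      by (auto simp: interior_def dx_wedge_nth insert_absorb simp flip: mult.assoc power_add)
  next
    case False
    show ?thesis
    proof (cases "a \<in> S \<and> b \<notin> S")
      case True
      have 1: "inversions {b} S = inversions {b} (S - {a}) + (if idx_less a b then 1 else 0)"
        using inversions_insert_right[of a "S - {a}" b] True by (simp add: insert_absorb)
      have 2: "insert b S - {a} = insert b (S - {a})" using False by auto
      have 3: "inversions {a} (insert b (S - {a})) = inversions {a} (S - {a}) + (if idx_less b a then 1 else 0)"
        using inversions_insert_right[of b "S - {a}" a] True by simp
      show ?thesis using True False idx_less_linear[OF False]
        by (auto simp: interior_def dx_wedge_nth 1 2 3 power_add)
    qed (use False in \<open>auto simp: interior_def dx_wedge_nth\<close>)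
  qed
qed

section \<open>Contractions and algebra homomorphisms\<close>

lemma interior_dx: "interior b (dx a) = (if a = b then one_form0 else 0)"
  using interior_dx_wedge[of b a one_form0] by simp

lemma contr_add_right: "K \<rightharpoondown> (\<alpha> + \<beta>) = K \<rightharpoondown> \<alpha> + K \<rightharpoondown> \<beta>"
  by (simp add: contr_def interior_add wedge_add_right sum.distrib)

lemma contr_smult_right: "K \<rightharpoondown> (c *s \<alpha>) = c *s (K \<rightharpoondown> \<alpha>)"
  by (simp add: contr_def interior_smult wedge_smult_right vec.scale_sum_right)

lemma contr_add_left: "(K + L) \<rightharpoondown> \<alpha> = K \<rightharpoondown> \<alpha> + L \<rightharpoondown> \<alpha>"
  by (simp add: contr_def wedge_add_left sum.distrib)

lemma contr_diff_left: "(K - L) \<rightharpoondown> \<alpha> = K \<rightharpoondown> \<alpha> - L \<rightharpoondown> \<alpha>"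
  by (simp add: contr_def wedge_diff_left sum_subtractf)

lemma contr_minus_left: "(- K) \<rightharpoondown> \<alpha> = - (K \<rightharpoondown> \<alpha>)"
  by (simp add: contr_def wedge_minus_left sum_negf)

lemma contr_zero_right [simp]: "K \<rightharpoondown> 0 = 0"
  using contr_smult_right[of K 0 0] by simp

lemma contr_sum_right: "K \<rightharpoondown> (\<Sum>i\<in>I. f i) = (\<Sum>i\<in>I. K \<rightharpoondown> f i)"
  by (induction I rule: infinite_finite_induct) (auto simp: contr_add_right)

lemma contr_one_form0 [simp]: "K \<rightharpoondown> one_form0 = 0"
  by (simp add: contr_def)

lemma contr_dx: "K \<rightharpoondown> dx a = K $ a"
  by (simp add: contr_def interior_dx if_distrib[of "wedge _"] cong: if_cong)

text \<open>The suffix is the parity of the components of K, not of the operator: components that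
  commute with covectors, as 2-forms do, make contraction an odd derivation, hence the minus
  sign.\<close>

lemma contr_dx_wedge_even:
  assumes "\<And>b. K $ b \<^bold>\<and> dx a = dx a \<^bold>\<and> K $ b"
  shows "K \<rightharpoondown> (dx a \<^bold>\<and> \<beta>) = K $ a \<^bold>\<and> \<beta> - dx a \<^bold>\<and> (K \<rightharpoondown> \<beta>)"
proof -
  have "K $ b \<^bold>\<and> dx a \<^bold>\<and> \<gamma> = dx a \<^bold>\<and> K $ b \<^bold>\<and> \<gamma>" for b \<gamma>
    using assms by (metis wedge_assoc)
  then show ?thesis
    by (simp add: contr_def interior_dx_wedge wedge_linear sum_subtractf if_distrib[of "wedge _"] cong: if_cong)
qed

text \<open>Components of degree 1 undo the sign of the antiderivation \<open>interior\<close>, so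
  contraction by a vector-valued 1-form is an even derivation.\<close>

lemma contr_dx_wedge_odd:
  assumes "\<And>b. K $ b \<in> covectors"
  shows "K \<rightharpoondown> (dx a \<^bold>\<and> \<beta>) = K $ a \<^bold>\<and> \<beta> + dx a \<^bold>\<and> (K \<rightharpoondown> \<beta>)"
proof -
  have "K $ b \<^bold>\<and> dx a \<^bold>\<and> \<gamma> = - (dx a \<^bold>\<and> K $ b \<^bold>\<and> \<gamma>)" for b \<gamma>
    using assms covector_left_anticommute dx_covector by blast
  then show ?thesis
    by (simp add: contr_def interior_dx_wedge wedge_linear sum.distrib sum_subtractf sum_negf
        if_distrib[of "wedge _"] cong: if_cong)
qed

lemma contr_covector_wedge:
  assumes K: "\<And>b. K $ b \<in> covectors" and "\<eta> \<in> covectors"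
  shows "K \<rightharpoondown> (\<eta> \<^bold>\<and> \<beta>) = (K \<rightharpoondown> \<eta>) \<^bold>\<and> \<beta> + \<eta> \<^bold>\<and> (K \<rightharpoondown> \<beta>)"
  using assms(2)
  by (induction rule: vec.span_induct_alt)
    (auto simp: wedge_linear contr_add_right contr_smult_right contr_dx_wedge_odd[OF K] contr_dx
      vec.scale_right_distrib)

section \<open>Homomorphisms of the exterior algebra\<close>

lemma wedge_family_empty [simp]: "wedge_family \<theta> {} = one_form0"
  by (simp add: wedge_family_def)

lemma wedge_family_insert_min:
  assumes "\<forall>j\<in>I. i < j"
  shows "wedge_family \<theta> (insert i I) = \<theta> i \<^bold>\<and> wedge_family \<theta> I"
proof -
  have "i \<notin> I" using assms by auto
  then have "sorted_list_of_set (insert i I) = insort i (sorted_list_of_set I)"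
    by (simp add: sorted_list_of_set_insert)
  also have "\<dots> = i # sorted_list_of_set I"
    using assms by (intro insort_is_Cons) (auto intro: less_imp_le)
  finally show ?thesis by (simp add: wedge_family_def)
qed

definition basis_image :: "('n + 'n \<Rightarrow> 'n form) \<Rightarrow> ('n + 'n) set \<Rightarrow> 'n::{finite,linorder} form" where
  "basis_image e S = wedge_family (\<lambda>i. e (Inl i)) {i. Inl i \<in> S} \<^bold>\<and> wedge_family (\<lambda>j. e (Inr j)) {j. Inr j \<in> S}"

text \<open>The prescription on sorted monomials copies the shape of \<open>exp_pair\<close>.
  Multiplicativity is thereby not built in; it is proved below when all \<open>e a\<close> are
  covectors.\<close>

definition alg_hom :: "('n + 'n \<Rightarrow> 'n form) \<Rightarrow> 'n form \<Rightarrow> 'n::{finite,linorder} form" where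
  "alg_hom e \<alpha> = (\<Sum>S\<in>UNIV. \<alpha> $ S *s basis_image e S)"

lemma basis_image_empty [simp]: "basis_image e {} = one_form0"
  by (simp add: basis_image_def)

lemma basis_image_insert_min:
  assumes "\<forall>b\<in>S. idx_less a b"
  shows "basis_image e (insert a S) = e a \<^bold>\<and> basis_image e S"
proof (cases a)
  case (Inl i)
  have "{k. Inl k \<in> insert a S} = insert i {k. Inl k \<in> S}" "{k. Inr k \<in> insert a S} = {k. Inr k \<in> S}"
    using Inl by auto
  moreover have "\<forall>j\<in>{k. Inl k \<in> S}. i < j" using assms Inl by force
  ultimately show ?thesis
    by (simp add: basis_image_def wedge_family_insert_min wedge_assoc Inl)
next
  case (Inr i)
  \<comment> \<open>A minimal \<open>Inr\<close> index excludes \<open>Inl\<close> indices, so the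
    first block is the unit and the new covector does not have to pass it.\<close>
  have "{k. Inl k \<in> S} = {}" using assms Inr by force
  moreover have "{k. Inl k \<in> insert a S} = {k. Inl k \<in> S}" "{k. Inr k \<in> insert a S} = insert i {k. Inr k \<in> S}"
    using Inr by auto
  moreover have "\<forall>j\<in>{k. Inr k \<in> S}. i < j" using assms Inr by force
  ultimately show ?thesis
    by (simp add: basis_image_def wedge_family_insert_min Inr)
qed

text \<open>The sign rules for multiplying a basis monomial by \<open>dx a\<close> rest on
  anticommutation and vanishing squares, which all covectors share. This is the core of
  multiplicativity.\<close>

lemma wedge_basis_image:
  fixes e :: "'n::{finite,linorder} + 'n \<Rightarrow> 'n form"
  assumes e: "\<And>a. e a \<in> covectors"
  shows "e a \<^bold>\<and> basis_image e S =
    (if a \<in> S then 0 else (-1) ^ inversions {a} S *s basis_image e (insert a S))"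
proof (induction S rule: idx_min_induct)
  case empty
  then show ?case by (simp add: basis_image_insert_min)
next
  case (insert b S)
  have b: "b \<notin> S" using insert by auto
  consider "a = b" | "a \<noteq> b" "idx_less a b" | "a \<noteq> b" "idx_less b a" using idx_less_linear by blast
  then show ?case
  proof cases
    case 1
    then show ?thesis using insert(1) by (simp add: basis_image_insert_min covector_square e)
  next
    case 2
    then have min: "\<forall>c\<in>insert b S. idx_less a c" using insert(1) idx_less_trans by blast
    then have "a \<notin> insert b S" by (metis idx_less_irrefl)
    then show ?thesis using min by (simp add: basis_image_insert_min[of "insert b S"] inversions_min)
  next
    \<comment> \<open>Here b stays in front: one transposition moves \<open>e a\<close> past
      \<open>e b\<close>, and the induction hypothesis sorts it into S.\<close>
    case 3
    then have min: "\<forall>c\<in>insert a S. idx_less b c" using insert(1) by blast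
    have "e a \<^bold>\<and> basis_image e (insert b S) = - (e b \<^bold>\<and> (e a \<^bold>\<and> basis_image e S))"
      using insert(1) by (simp only: basis_image_insert_min covector_left_anticommute[OF e e, of a b])
    also have "\<dots> = (if a \<in> S then 0 else - ((-1) ^ inversions {a} S *s basis_image e (insert b (insert a S))))"
      unfolding insert(2) by (simp add: wedge_linear basis_image_insert_min[OF min])
    also have "\<dots> = (if a \<in> insert b S then 0
        else (-1) ^ inversions {a} (insert b S) *s basis_image e (insert a (insert b S)))"
      using 3 by (simp add: inversions_insert_right b insert_commute)
    finally show ?thesis .
  qed
qed

lemma alg_hom_axis [simp]: "alg_hom e (axis S 1) = basis_image e S"
  by (simp add: alg_hom_def axis_def if_distrib[of "\<lambda>x. x *s _"] cong: if_cong)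

lemma alg_hom_add: "alg_hom e (\<alpha> + \<beta>) = alg_hom e \<alpha> + alg_hom e \<beta>"
  by (simp add: alg_hom_def vec.scale_left_distrib sum.distrib)

lemma alg_hom_smult: "alg_hom e (c *s \<alpha>) = c *s alg_hom e \<alpha>"
  by (simp add: alg_hom_def vec.scale_sum_right)

lemma alg_hom_zero [simp]: "alg_hom e 0 = 0"
  by (simp add: alg_hom_def)

lemma alg_hom_diff: "alg_hom e (\<alpha> - \<beta>) = alg_hom e \<alpha> - alg_hom e \<beta>"
  by (simp add: alg_hom_def vec.scale_left_diff_distrib sum_subtractf)

lemma alg_hom_sum: "alg_hom e (\<Sum>i\<in>I. f i) = (\<Sum>i\<in>I. alg_hom e (f i))"
  by (induction I rule: infinite_finite_induct) (auto simp: alg_hom_add)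

lemma alg_hom_one_form0 [simp]: "alg_hom e one_form0 = one_form0"
  unfolding one_form0_def alg_hom_axis basis_image_empty ..

lemma alg_hom_dx_wedge:
  fixes e :: "'n::{finite,linorder} + 'n \<Rightarrow> 'n form"
  assumes e: "\<And>a. e a \<in> covectors"
  shows "alg_hom e (dx a \<^bold>\<and> \<beta>) = e a \<^bold>\<and> alg_hom e \<beta>"
proof -
  have "alg_hom e (dx a \<^bold>\<and> axis S 1) = e a \<^bold>\<and> basis_image e S" for S
    by (cases "a \<in> S") (simp_all add: dx_wedge_axis dx_wedge_axis_in wedge_basis_image[where e = e, OF e] alg_hom_smult)
  then have "alg_hom e (dx a \<^bold>\<and> (\<Sum>S\<in>UNIV. \<beta> $ S *s axis S 1)) = e a \<^bold>\<and> alg_hom e (\<Sum>S\<in>UNIV. \<beta> $ S *s axis S 1)"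
    by (simp only: wedge_linear alg_hom_sum alg_hom_smult alg_hom_axis)
  then show ?thesis by (simp only: basis_expansion)
qed

lemma alg_hom_dx:
  fixes e :: "'n::{finite,linorder} + 'n \<Rightarrow> 'n form"
  assumes "\<And>a. e a \<in> covectors"
  shows "alg_hom e (dx a) = e a"
  using alg_hom_dx_wedge[where e = e, OF assms, of a one_form0] by simp

lemma alg_hom_wedge:
  fixes e :: "'n::{finite,linorder} + 'n \<Rightarrow> 'n form"
  assumes e: "\<And>a. e a \<in> covectors"
  shows "alg_hom e (\<alpha> \<^bold>\<and> \<beta>) = alg_hom e \<alpha> \<^bold>\<and> alg_hom e \<beta>"
  by (rule linear_form_eqI[where \<alpha> = \<alpha>])
    (simp_all add: wedge_linear alg_hom_add alg_hom_smult wedge_assoc alg_hom_dx_wedge[where e = e, OF e])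

section \<open>Exponentials of contractions\<close>

text \<open>\<open>exp_contr\<close> is an infinite sum, whose value is meaningful only once
  convergence is known. For arbitrary K the operator \<open>contr K\<close> need not be nilpotent,
  so the series is dominated by that of exp B with B a bound for the operator.\<close>

lemma exp_contr_sums:
  fixes \<alpha> :: "'n::{finite,linorder} form"
  shows "(\<lambda>k. (1 / fact k) *\<^sub>R ((contr K ^^ k) \<alpha>)) sums exp_contr K \<alpha>"
proof -
  have "linear (contr K)"
    by (auto intro!: linearI simp: contr_add_right contr_smult_right scaleR_form)
  then interpret bounded_linear "contr K" by (simp add: linear_conv_bounded_linear)
  obtain B where B: "0 < B" "\<And>x. norm (K \<rightharpoondown> x) \<le> norm x * B" using pos_bounded by blast
  have "norm ((contr K ^^ k) \<alpha>) \<le> B ^ k * norm \<alpha>" for k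
  proof (induction k)
    case (Suc k)
    have "norm ((contr K ^^ Suc k) \<alpha>) \<le> norm ((contr K ^^ k) \<alpha>) * B" using B by simp
    also have "\<dots> \<le> (B ^ k * norm \<alpha>) * B" using Suc B by (intro mult_right_mono) auto
    finally show ?case by (simp add: mult_ac)
  qed simp
  then have "norm ((1 / fact k) *\<^sub>R ((contr K ^^ k) \<alpha>)) \<le> (B ^ k /\<^sub>R fact k) * norm \<alpha>" for k
    by (simp add: field_simps)
  moreover have "summable (\<lambda>k. (B ^ k /\<^sub>R fact k) * norm \<alpha>)"
    by (rule summable_mult2[OF summable_exp_generic])
  ultimately have "summable (\<lambda>k. (1 / fact k) *\<^sub>R ((contr K ^^ k) \<alpha>))"
    by (rule summable_comparison_test'[where N = 0, rotated])
  then show ?thesis unfolding exp_contr_def by (rule summable_sums)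
qed

lemma exp_contr_one_form0: "exp_contr K one_form0 = one_form0"
proof -
  have "(contr K ^^ k) one_form0 = (if k = 0 then one_form0 else 0)" for k
    by (induction k) auto
  then have "(\<lambda>k. (1 / fact k) *\<^sub>R ((contr K ^^ k) one_form0)) = (\<lambda>k. if k = 0 then one_form0 else 0)"
    by auto
  then have "(\<lambda>k. if k = 0 then one_form0 else 0) sums exp_contr K one_form0"
    using exp_contr_sums[of K one_form0] by simp
  then show ?thesis
    using sums_single[of 0 "\<lambda>_. one_form0"] by (rule sums_unique2)
qed

text \<open>Leibniz rule for the powers of the derivation \<open>contr K\<close>, whose square kills \<open>dx a\<close>.\<close>

lemma exp_contr_dx_wedge:
  fixes \<beta> :: "'n::{finite,linorder} form"
  assumes K: "\<And>b. K $ b \<in> covectors" and K2: "K \<rightharpoondown> K $ a = 0"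
  shows "exp_contr K (dx a \<^bold>\<and> \<beta>) = (dx a + K $ a) \<^bold>\<and> exp_contr K \<beta>"
proof -
  interpret bounded_bilinear "wedge :: 'n form \<Rightarrow> _" by (rule bounded_bilinear_wedge)
  define N where "N = contr K"
  have N_dx: "N (dx a \<^bold>\<and> \<gamma>) = K $ a \<^bold>\<and> \<gamma> + dx a \<^bold>\<and> N \<gamma>" for \<gamma>
    unfolding N_def by (rule contr_dx_wedge_odd[OF K])
  have N_K: "N (K $ a \<^bold>\<and> \<gamma>) = K $ a \<^bold>\<and> N \<gamma>" for \<gamma>
    unfolding N_def using K2 by (simp add: contr_covector_wedge[OF K K])
  have N_add: "N (x + y) = N x + N y" and N_smult: "N (c *s x) = c *s N x" for x y c
    by (simp_all add: N_def contr_add_right contr_smult_right)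
  \<comment> \<open>In the Leibniz expansion at most one factor hits \<open>dx a\<close>, because a
    second one would give K contracted into \<open>K $ a\<close>. At k = 0 the truncated
    \<open>k - 1\<close> is multiplied by 0.\<close>
  have pow: "(N ^^ k) (dx a \<^bold>\<and> \<beta>) = dx a \<^bold>\<and> (N ^^ k) \<beta> + of_nat k *s (K $ a \<^bold>\<and> (N ^^ (k - 1)) \<beta>)" for k
  proof (induction k)
    case (Suc k)
    have "of_nat k *s (K $ a \<^bold>\<and> N ((N ^^ (k - 1)) \<beta>)) = of_nat k *s (K $ a \<^bold>\<and> (N ^^ k) \<beta>)"
      by (cases k) auto
    then show ?case
      by (simp add: Suc N_add N_smult N_dx N_K vec.scale_left_distrib)
  qed simp
  define g where "g k = (1 / fact k) *\<^sub>R ((N ^^ k) \<beta>)" for k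
  have g: "g sums exp_contr K \<beta>"
    using exp_contr_sums[of K \<beta>] unfolding g_def N_def .
  have "(\<lambda>k. dx a \<^bold>\<and> g k) sums (dx a \<^bold>\<and> exp_contr K \<beta>)"
    by (rule bounded_linear.sums[OF bounded_linear_right g])
  moreover have "(\<lambda>k. K $ a \<^bold>\<and> g k) sums (K $ a \<^bold>\<and> exp_contr K \<beta>)"
    by (rule bounded_linear.sums[OF bounded_linear_right g])
  \<comment> \<open>Since k / k! = 1 / (k - 1)!, the second summand of \<open>pow\<close> yields
    this series shifted by one place, with the same sum.\<close>
  then have "(\<lambda>k. if k = 0 then 0 else K $ a \<^bold>\<and> g (k - 1)) sums (K $ a \<^bold>\<and> exp_contr K \<beta>)"
    using sums_Suc_imp[of "\<lambda>k. if k = 0 then 0 else K $ a \<^bold>\<and> g (k - 1)"] by simp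
  ultimately have "(\<lambda>k. dx a \<^bold>\<and> g k + (if k = 0 then 0 else K $ a \<^bold>\<and> g (k - 1))) sums
      (dx a \<^bold>\<and> exp_contr K \<beta> + K $ a \<^bold>\<and> exp_contr K \<beta>)"
    by (rule sums_add)
  moreover have "dx a \<^bold>\<and> g k + (if k = 0 then 0 else K $ a \<^bold>\<and> g (k - 1)) = (1 / fact k) *\<^sub>R ((N ^^ k) (dx a \<^bold>\<and> \<beta>))" for k
  proof (cases k)
    case (Suc j)
    have "(1 / fact (Suc j)) *\<^sub>R (of_nat (Suc j) *s x) = (1 / fact j) *\<^sub>R x" for x :: "'n form"
      by (simp add: scaleR_form vec_eq_iff field_simps del: of_nat_Suc)
    then show ?thesis unfolding pow Suc
      by (simp add: g_def scaleR_add_right scaleR_right del: fact_Suc of_nat_Suc funpow.simps)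
  qed (simp add: g_def)
  ultimately show ?thesis
    using exp_contr_sums[of K "dx a \<^bold>\<and> \<beta>"] sums_unique2 by (simp add: N_def wedge_add_left)
qed

definition row_form :: "('n \<Rightarrow> 'n + 'n) \<Rightarrow> (complex, 'n) vec \<Rightarrow> 'n::{finite,linorder} form" where
  "row_form s v = (\<Sum>l\<in>UNIV. v $ l *s dx (s l))"

lemma row_form_covector [simp]: "row_form s v \<in> covectors"
  unfolding row_form_def by (intro vec.span_sum vec.span_scale) simp

lemma row_form_add: "row_form s (v + w) = row_form s v + row_form s w"
  by (simp add: row_form_def vec.scale_left_distrib sum.distrib)

lemma row_form_diff: "row_form s (v - w) = row_form s v - row_form s w"
  by (simp add: row_form_def vec.scale_left_diff_distrib sum_subtractf)

lemma row_form_axis: "row_form s (axis i 1) = dx (s i)"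
  by (simp add: row_form_def axis_def if_distrib[of "\<lambda>x. x *s _"] cong: if_cong)

lemma row_form_mult: "row_form s ((M ** N) $ i) = (\<Sum>k\<in>UNIV. M $ i $ k *s row_form s (N $ k))"
  by (simp add: row_form_def matrix_matrix_mult_def vec.scale_sum_right vec.scale_sum_left)
    (rule sum.swap)

lemma map_form_nth: "inj u \<Longrightarrow> map_form u s M $ u i = row_form s (M $ i)"
  by (simp add: map_form_def row_form_def inj_eq if_distrib[of "\<lambda>x. x *s _"] cong: if_cong)

lemma map_form_nth_other: "a \<notin> range u \<Longrightarrow> map_form u s M $ a = 0"
  by (simp add: map_form_def) (rule sum.neutral, auto)

lemma map_form_covector [simp]: "map_form u s M $ a \<in> covectors"
  unfolding map_form_def by (auto intro!: vec.span_sum vec.span_scale vec.span_zero)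

lemma contr_row_form: "K \<rightharpoondown> row_form s v = (\<Sum>l\<in>UNIV. v $ l *s K $ s l)"
  by (simp add: row_form_def contr_sum_right contr_smult_right contr_dx)

text \<open>Contraction turns \<open>dx (u i)\<close> into a combination of the
  \<open>dx (s l)\<close> and annihilates these, the two ranges being disjoint. Hence the
  exponential adds just one correction term to each factor.\<close>

lemma exp_contr_wedge_family:
  fixes u s :: "'n::{finite,linorder} \<Rightarrow> 'n + 'n"
  assumes u: "inj u" and us: "range u \<inter> range s = {}"
  shows "exp_contr (map_form u s M) (wedge_family (\<lambda>i. dx (u i)) I) =
    wedge_family (\<lambda>i. dx (u i) + row_form s (M $ i)) I"
  using finite[of I]
proof (induction I rule: finite_linorder_min_induct)
  case empty
  then show ?case by (simp add: exp_contr_one_form0)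
next
  case (insert i I)
  have "map_form u s M \<rightharpoondown> row_form s v = 0" for v
    proof -
    have "map_form u s M $ s l = 0" for l
      using us by (intro map_form_nth_other) auto
    then show ?thesis by (simp add: contr_row_form)
  qed
  then show ?case using insert
    by (simp add: wedge_family_insert_min exp_contr_dx_wedge map_form_nth[OF u])
qed

definition exp_frame :: "((complex, 'n) vec, 'n) vec \<Rightarrow> 'n + 'n \<Rightarrow> 'n::{finite,linorder} form" where
  "exp_frame P a = (case a of Inl i \<Rightarrow> dx (Inl i) + row_form Inr (P $ i)
     | Inr i \<Rightarrow> dx (Inr i) + row_form Inl (cnj_mat P $ i))"

lemma exp_frame_covector [simp]: "exp_frame P a \<in> covectors"
  by (cases a) (simp_all add: exp_frame_def vec.span_add)

text \<open>Each exponential is applied only to the block of covectors that it moves, so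
  \<open>exp_pair\<close> substitutes \<open>exp_frame P\<close> into every sorted monomial.
  Afterwards no exponential series is handled.\<close>

lemma exp_pair_eq_alg_hom: "exp_pair P = alg_hom (exp_frame P)"
proof -
  have "exp_contr (phi_form P) (wedge_family (\<lambda>i. dx (Inl i)) I) = wedge_family (\<lambda>i. exp_frame P (Inl i)) I" for I
    unfolding phi_form_def by (subst exp_contr_wedge_family) (auto simp: exp_frame_def)
  moreover have "exp_contr (phibar_form P) (wedge_family (\<lambda>j. dx (Inr j)) I) = wedge_family (\<lambda>j. exp_frame P (Inr j)) I" for I
    unfolding phibar_form_def by (subst exp_contr_wedge_family) (auto simp: exp_frame_def)
  ultimately show ?thesis
    by (simp add: exp_pair_def alg_hom_def basis_image_def fun_eq_iff)
qed

section \<open>Wirtinger calculus\<close>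

lemma sum_UNIV_sum: "(\<Sum>a\<in>UNIV. f a) = (\<Sum>i\<in>UNIV. f (Inl i)) + (\<Sum>j\<in>UNIV. f (Inr j))"
  for f :: "'a::finite + 'b::finite \<Rightarrow> 'c::comm_monoid_add"
  by (simp add: UNIV_Plus_UNIV[symmetric] sum.Plus del: UNIV_Plus_UNIV)

lemma linear_differentiable:
  fixes f :: "'a::euclidean_space \<Rightarrow> 'b::real_normed_vector"
  assumes "linear f" "g differentiable F"
  shows "(\<lambda>y. f (g y)) differentiable F"
  using assms linear_conv_bounded_linear bounded_linear.has_derivative unfolding differentiable_def by blast

lemma bounded_bilinear_differentiable:
  assumes "bounded_bilinear m" "f differentiable (at z)" "g differentiable (at z)"
  shows "(\<lambda>y. m (f y) (g y)) differentiable (at z)"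
  using assms bounded_bilinear.FDERIV unfolding differentiable_def by blast

lemma bounded_bilinear_smult: "bounded_bilinear ((*s) :: complex \<Rightarrow> (complex, 'b::finite) vec \<Rightarrow> _)"
proof -
  have "bilinear ((*s) :: complex \<Rightarrow> (complex, 'b::finite) vec \<Rightarrow> _)"
    unfolding bilinear_def
    by (auto intro!: linearI simp: vec.scale_left_distrib vec.scale_right_distrib scaleR_form vec_eq_iff
        scaleR_conv_of_real[where 'a = complex])
  then show ?thesis by (simp add: bilinear_conv_bounded_bilinear)
qed

lemmas differentiable_smult = bounded_bilinear_differentiable[OF bounded_bilinear_smult]
  and differentiable_wedge = bounded_bilinear_differentiable[OF bounded_bilinear_wedge]

lemma differentiable_vec_nth: "f differentiable F \<Longrightarrow> (\<lambda>y. f y $ i) differentiable F"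
  for f :: "_ \<Rightarrow> (_::real_normed_vector, 'b::finite) vec"
  using bounded_linear.has_derivative[OF bounded_linear_vec_nth] unfolding differentiable_def by blast

lemma differentiable_sum_fun:
  assumes "\<And>i. i \<in> I \<Longrightarrow> f i differentiable F"
  shows "(\<lambda>y. \<Sum>i\<in>I. f i y) differentiable F"
  using assms by (cases "finite I") auto

lemma differentiable_prod_fun:
  fixes f :: "'i \<Rightarrow> 'a::real_normed_vector \<Rightarrow> 'b::{real_normed_algebra, comm_monoid_mult}"
  assumes "\<And>i. i \<in> I \<Longrightarrow> f i differentiable (at z)"
  shows "(\<lambda>y. \<Prod>i\<in>I. f i y) differentiable (at z)"
  using assms by (induction I rule: infinite_finite_induct) (auto intro!: differentiable_mult)

lemma dir_deriv_works:
  "f differentiable (at z) \<Longrightarrow> (f has_derivative dir_deriv f z) (at z)"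
  unfolding dir_deriv_def[abs_def] by (simp flip: frechet_derivative_works)

lemma dir_deriv_eqI: "(f has_derivative D) (at z) \<Longrightarrow> dir_deriv f z v = D v"
  unfolding dir_deriv_def by (metis frechet_derivative_at)

lemma dir_deriv_const [simp]: "dir_deriv (\<lambda>_. c) z v = 0"
  by (rule dir_deriv_eqI) simp

lemma dir_deriv_add:
  assumes "f differentiable (at z)" "g differentiable (at z)"
  shows "dir_deriv (\<lambda>y. f y + g y) z v = dir_deriv f z v + dir_deriv g z v"
  using has_derivative_add[OF assms[THEN dir_deriv_works]] by (rule dir_deriv_eqI)

lemma dir_deriv_sum:
  assumes "\<And>i. i \<in> I \<Longrightarrow> f i differentiable (at z)"
  shows "dir_deriv (\<lambda>y. \<Sum>i\<in>I. f i y) z v = (\<Sum>i\<in>I. dir_deriv (f i) z v)"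
  by (rule dir_deriv_eqI) (intro has_derivative_sum dir_deriv_works assms)

lemma dir_deriv_bilinear:
  assumes "bounded_bilinear m" "f differentiable (at z)" "g differentiable (at z)"
  shows "dir_deriv (\<lambda>y. m (f y) (g y)) z v = m (f z) (dir_deriv g z v) + m (dir_deriv f z v) (g z)"
  using bounded_bilinear.FDERIV[OF assms(1) assms(2,3)[THEN dir_deriv_works]] by (rule dir_deriv_eqI)

lemma dir_deriv_linear:
  fixes F :: "'b::euclidean_space \<Rightarrow> 'c::real_normed_vector"
  assumes "linear F" "f differentiable (at z)"
  shows "dir_deriv (\<lambda>y. F (f y)) z v = F (dir_deriv f z v)"
proof -
  have "bounded_linear F" using assms(1) by (simp add: linear_conv_bounded_linear)
  from bounded_linear.has_derivative[OF this dir_deriv_works[OF assms(2)]] show ?thesis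
    by (rule dir_deriv_eqI)
qed

text \<open>Scalar version of \<open>wirtinger\<close>, for the coefficients of forms and the
  entries of matrices.\<close>

definition wirt :: "'n + 'n \<Rightarrow> ((complex, 'n) vec \<Rightarrow> complex) \<Rightarrow> (complex, 'n::finite) vec \<Rightarrow> complex" where
  "wirt a f z = (case a of
     Inl i \<Rightarrow> (dir_deriv f z (axis i 1) - \<i> * dir_deriv f z (axis i \<i>)) / 2
   | Inr i \<Rightarrow> (dir_deriv f z (axis i 1) + \<i> * dir_deriv f z (axis i \<i>)) / 2)"

lemma wirt_mult:
  "f differentiable (at z) \<Longrightarrow> g differentiable (at z) \<Longrightarrow>
    wirt a (\<lambda>y. f y * g y) z = wirt a f z * g z + f z * wirt a g z"
  by (simp add: wirt_def dir_deriv_bilinear[OF bounded_bilinear_mult] field_simps split: sum.split)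

lemma wirt_const [simp]: "wirt a (\<lambda>_. c) z = 0"
  by (simp add: wirt_def split: sum.split)

lemma wirt_sum:
  assumes "\<And>i. i \<in> I \<Longrightarrow> f i differentiable (at z)"
  shows "wirt a (\<lambda>y. \<Sum>i\<in>I. f i y) z = (\<Sum>i\<in>I. wirt a (f i) z)"
  using assms
  by (simp add: wirt_def dir_deriv_sum sum_distrib_left sum_divide_distrib sum_subtractf sum.distrib
      diff_divide_distrib add_divide_distrib split: sum.split)

lemma wirt_cnj:
  assumes "f differentiable (at z)"
  shows "wirt a (\<lambda>y. cnj (f y)) z = cnj (wirt (case a of Inl i \<Rightarrow> Inr i | Inr i \<Rightarrow> Inl i) f z)"
proof -
  have "dir_deriv (\<lambda>y. cnj (f y)) z v = cnj (dir_deriv f z v)" for v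
    by (rule dir_deriv_linear[OF _ assms]) (auto intro: linearI)
  then show ?thesis by (simp add: wirt_def split: sum.split)
qed

lemma wirtinger_nth:
  assumes "\<alpha> differentiable (at z)"
  shows "wirtinger a \<alpha> z $ S = wirt a (\<lambda>y. \<alpha> y $ S) z"
proof -
  have "dir_deriv (\<lambda>y. \<alpha> y $ S) z v = dir_deriv \<alpha> z v $ S" for v
    by (rule dir_deriv_linear[OF _ assms]) (auto intro: linearI)
  then show ?thesis by (cases a) (simp_all add: wirt_def)
qed

lemma wirtinger_const [simp]: "wirtinger a (\<lambda>_. \<beta>) z = 0"
  by (cases a) auto

lemma wirtinger_add:
  "\<alpha> differentiable (at z) \<Longrightarrow> \<beta> differentiable (at z) \<Longrightarrow>
    wirtinger a (\<lambda>y. \<alpha> y + \<beta> y) z = wirtinger a \<alpha> z + wirtinger a \<beta> z"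
  by (cases a) (simp_all add: dir_deriv_add vec.scale_right_distrib vec.scale_right_diff_distrib)

lemma wirtinger_sum:
  assumes "\<And>i. i \<in> I \<Longrightarrow> f i differentiable (at z)"
  shows "wirtinger a (\<lambda>y. \<Sum>i\<in>I. f i y) z = (\<Sum>i\<in>I. wirtinger a (f i) z)"
  using assms
  by (cases a) (simp_all add: dir_deriv_sum vec.scale_sum_right vec.scale_right_distrib
      vec.scale_right_diff_distrib sum_subtractf sum.distrib)

lemma wirtinger_smult:
  assumes "f differentiable (at z)" "\<alpha> differentiable (at z)"
  shows "wirtinger a (\<lambda>y. f y *s \<alpha> y) z = wirt a f z *s \<alpha> z + f z *s wirtinger a \<alpha> z"
  using assms
  by (cases a) (simp_all add: wirt_def dir_deriv_bilinear[OF bounded_bilinear_smult] vec_eq_iff field_simps)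

lemma wirtinger_wedge:
  assumes "\<alpha> differentiable (at z)" "\<beta> differentiable (at z)"
  shows "wirtinger a (\<lambda>y. \<alpha> y \<^bold>\<and> \<beta> y) z = wirtinger a \<alpha> z \<^bold>\<and> \<beta> z + \<alpha> z \<^bold>\<and> wirtinger a \<beta> z"
  using assms
  by (cases a) (simp_all add: dir_deriv_bilinear[OF bounded_bilinear_wedge] wedge_linear
      vec.scale_right_distrib vec.scale_right_diff_distrib)

lemma linear_interior: "linear (interior b)"
  by (intro linearI) (simp_all add: interior_add interior_smult scaleR_form)

lemma interior_diff: "interior a (\<alpha> - \<beta>) = interior a \<alpha> - interior a \<beta>"
  by (simp add: interior_def vec_eq_iff algebra_simps)

lemma wirtinger_interior:
  assumes "\<alpha> differentiable (at z)"
  shows "wirtinger a (\<lambda>y. interior b (\<alpha> y)) z = interior b (wirtinger a \<alpha> z)"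
  by (cases a) (simp_all add: dir_deriv_linear[OF linear_interior assms] interior_add interior_diff interior_smult)

lemma wirtinger_contr:
  assumes K: "\<And>b. (\<lambda>y. K y $ b) differentiable (at z)" and w: "w differentiable (at z)"
  shows "wirtinger a (\<lambda>y. K y \<rightharpoondown> w y) z =
    (\<chi> b. wirtinger a (\<lambda>y. K y $ b) z) \<rightharpoondown> w z + K z \<rightharpoondown> wirtinger a w z"
  unfolding contr_def
  by (subst wirtinger_sum)
    (simp_all add: K w differentiable_wedge linear_differentiable[OF linear_interior]
      wirtinger_wedge wirtinger_interior sum.distrib)

section \<open>Dolbeault operators and their commutators with contractions\<close>

definition partial_d ::
    "('n \<Rightarrow> 'n + 'n) \<Rightarrow> ((complex, 'n) vec \<Rightarrow> 'n form) \<Rightarrow> (complex, 'n::{finite,linorder}) vec \<Rightarrow> 'n form" where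
  "partial_d u \<alpha> z = (\<Sum>i\<in>UNIV. dx (u i) \<^bold>\<and> wirtinger (u i) \<alpha> z)"

lemma del_eq_partial_d: "del = partial_d Inl" and delbar_eq_partial_d: "delbar = partial_d Inr"
  by (simp_all add: fun_eq_iff del_def delbar_def partial_d_def)

text \<open>Sorting the expression in real coordinates by the covectors \<open>dx (Inl i)\<close>
  and \<open>dx (Inr i)\<close> produces the two Wirtinger derivatives.\<close>

lemma ext_d_eq: "ext_d \<alpha> z = partial_d Inl \<alpha> z + partial_d Inr \<alpha> z"
proof -
  have c: "1 / (2 * \<i>) = - \<i> / 2" by (simp add: field_simps)
  show ?thesis
    unfolding ext_d_def partial_d_def sum.distrib[symmetric] c
    by (rule sum.cong) (simp_all add: wedge_linear vec_eq_iff field_simps)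
qed

lemma ext_d_sum: "ext_d \<alpha> z = (\<Sum>a\<in>UNIV. dx a \<^bold>\<and> wirtinger a \<alpha> z)"
  by (simp add: ext_d_eq partial_d_def sum_UNIV_sum)

definition vpartial_d ::
    "('n \<Rightarrow> 'n + 'n) \<Rightarrow> ((complex, 'n) vec \<Rightarrow> 'n vform) \<Rightarrow> (complex, 'n::{finite,linorder}) vec \<Rightarrow> 'n vform" where
  "vpartial_d u K z = (\<chi> a. partial_d u (\<lambda>y. K y $ a) z)"

text \<open>Contraction by \<open>K z\<close> is an even derivation. On the product of
  \<open>dx (u i)\<close> with a derivative of w it hits either factor; the second contribution
  cancels against the part of \<open>partial_d u\<close> of the contraction that differentiates w.
  What remains is a first-order term with coefficients \<open>K z $ u i\<close> and a zeroth-order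
  term from the derivative of K.\<close>

lemma contr_partial_d_commutator:
  assumes K: "\<And>b. (\<lambda>y. K y $ b) differentiable (at z)" "\<And>b. K z $ b \<in> covectors"
    and w: "w differentiable (at z)"
  shows "K z \<rightharpoondown> partial_d u w z - partial_d u (\<lambda>y. K y \<rightharpoondown> w y) z =
    (\<Sum>i\<in>UNIV. K z $ u i \<^bold>\<and> wirtinger (u i) w z) - vpartial_d u K z \<rightharpoondown> w z"
proof -
  have "vpartial_d u K z \<rightharpoondown> w z =
      (\<Sum>i\<in>UNIV. dx (u i) \<^bold>\<and> ((\<chi> b. wirtinger (u i) (\<lambda>y. K y $ b) z) \<rightharpoondown> w z))"
    unfolding contr_def vpartial_d_def partial_d_def
    by (simp add: wedge_linear wedge_assoc) (rule sum.swap)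
  then show ?thesis
    by (simp add: partial_d_def contr_sum_right contr_dx_wedge_odd K wirtinger_contr[OF K(1) w]
        wedge_linear sum.distrib)
qed

section \<open>Matrix-valued functions and their inverses\<close>

definition wirt_mat :: "'n + 'n \<Rightarrow> ((complex, 'n) vec \<Rightarrow> ((complex, 'n) vec, 'n) vec) \<Rightarrow> (complex, 'n::finite) vec
    \<Rightarrow> ((complex, 'n) vec, 'n) vec" where
  "wirt_mat a M z = (\<chi> i l. wirt a (\<lambda>y. M y $ i $ l) z)"

text \<open>Entrywise, because Wirtinger derivatives, determinants and Cramer's rule all address
  single entries.\<close>

definition mat_differentiable ::
    "('a::real_normed_vector \<Rightarrow> ((complex, 'm::finite) vec, 'n::finite) vec) \<Rightarrow> 'a \<Rightarrow> bool" where
  "mat_differentiable M z \<longleftrightarrow> (\<forall>i l. (\<lambda>y. M y $ i $ l :: complex) differentiable (at z))"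

lemma mat_differentiable_mult:
  "mat_differentiable M z \<Longrightarrow> mat_differentiable N z \<Longrightarrow> mat_differentiable (\<lambda>y. M y ** N y) z"
  unfolding mat_differentiable_def matrix_matrix_mult_def
  by (auto intro!: differentiable_sum_fun differentiable_mult)

lemma wirt_mat_mult:
  assumes "mat_differentiable M z" "mat_differentiable N z"
  shows "wirt_mat a (\<lambda>y. M y ** N y) z = wirt_mat a M z ** N z + M z ** wirt_mat a N z"
  using assms
  by (simp add: mat_differentiable_def wirt_mat_def matrix_matrix_mult_def vec_eq_iff wirt_sum wirt_mult
      differentiable_mult sum.distrib)

lemma differentiable_row_form:
  assumes "mat_differentiable M z"
  shows "(\<lambda>y. row_form s (M y $ i)) differentiable (at z)"
  using assms unfolding row_form_def mat_differentiable_def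
  by (intro differentiable_sum_fun differentiable_smult) auto

lemma wirtinger_row_form:
  assumes "mat_differentiable M z"
  shows "wirtinger a (\<lambda>y. row_form s (M y $ i)) z = row_form s (wirt_mat a M z $ i)"
  using assms unfolding mat_differentiable_def row_form_def
  by (subst wirtinger_sum) (auto simp: differentiable_smult wirtinger_smult wirt_mat_def)

lemma differentiable_map_form:
  assumes "mat_differentiable M z"
  shows "(\<lambda>y. map_form u s (M y) $ a) differentiable (at z)"
proof -
  have "(\<lambda>y. map_form u s (M y) $ a) = (\<lambda>y. \<Sum>i\<in>UNIV. if a = u i then row_form s (M y $ i) else 0)"
    by (simp add: map_form_def row_form_def cong: if_cong)
  moreover have "(\<lambda>y. if a = u i then row_form s (M y $ i) else 0) differentiable (at z)" for i
    using differentiable_row_form[OF assms] by (cases "a = u i") auto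
  ultimately show ?thesis by (simp add: differentiable_sum_fun)
qed

lemma vpartial_d_map_form:
  assumes "inj t" "mat_differentiable M z"
  shows "vpartial_d u (\<lambda>y. map_form t s (M y)) z $ t i =
    (\<Sum>j\<in>UNIV. dx (u j) \<^bold>\<and> row_form s (wirt_mat (u j) M z $ i))"
  using assms by (simp add: vpartial_d_def partial_d_def map_form_nth wirtinger_row_form)

lemma vpartial_d_map_form_other:
  assumes "a \<notin> range t"
  shows "vpartial_d u (\<lambda>y. map_form t s (M y)) z $ a = 0"
  using assms by (simp add: vpartial_d_def partial_d_def map_form_nth_other)

lemma matrix_inv_inverse:
  fixes M :: "((complex, 'n) vec, 'n::finite) vec"
  assumes "invertible M"
  shows "M ** matrix_inv M = mat 1" "matrix_inv M ** M = mat 1"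
  using someI_ex[OF assms[unfolded invertible_def]] by (simp_all add: matrix_inv_def)

text \<open>Cramer's rule, solved for the j-th unit vector. It presents the inverse as a quotient of
  polynomials in the entries, from which differentiability can be read off.\<close>

lemma matrix_inv_nth:
  fixes M :: "((complex, 'n) vec, 'n::finite) vec"
  assumes "det M \<noteq> 0"
  shows "matrix_inv M $ k $ j = det (\<chi> i l. if l = k then axis j 1 $ i else M $ i $ l) / det M"
proof -
  have "M ** matrix_inv M = mat 1"
    using assms by (simp add: matrix_inv_inverse invertible_det_nz)
  then have "M *v (matrix_inv M *v axis j 1) = axis j 1"
    by (simp add: matrix_vector_mul_assoc)
  then have "matrix_inv M *v axis j 1 = (\<chi> k. det (\<chi> i l. if l = k then axis j 1 $ i else M $ i $ l) / det M)"
    using cramer[OF assms] by blast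
  moreover have "(matrix_inv M *v axis j 1) $ k = matrix_inv M $ k $ j"
    by (simp add: matrix_vector_mult_def axis_def if_distrib cong: if_cong)
  ultimately show ?thesis by simp
qed

lemma differentiable_det:
  "mat_differentiable M z \<Longrightarrow> (\<lambda>y. det (M y)) differentiable (at z)"
  unfolding det_def mat_differentiable_def
  by (intro differentiable_sum_fun differentiable_mult differentiable_prod_fun) auto

lemma mat_differentiable_matrix_inv:
  fixes M :: "'a::real_normed_vector \<Rightarrow> ((complex, 'n) vec, 'n::finite) vec"
  assumes M: "mat_differentiable M z" and inv: "invertible (M z)"
  shows "mat_differentiable (\<lambda>y. matrix_inv (M y)) z"
  unfolding mat_differentiable_def
proof (intro allI)
  fix k j
  have det: "(\<lambda>y. det (M y)) differentiable (at z)" by (rule differentiable_det[OF M])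
  have nz: "det (M z) \<noteq> 0" using inv invertible_det_nz by blast
  have "mat_differentiable (\<lambda>y. \<chi> i l. if l = k then axis j 1 $ i else M y $ i $ l) z"
    unfolding mat_differentiable_def
  proof (intro allI)
    fix i l
    show "(\<lambda>y. (\<chi> i l. if l = k then axis j 1 $ i else M y $ i $ l) $ i $ l) differentiable (at z)"
      using M by (cases "l = k") (simp_all add: mat_differentiable_def)
  qed
  then have *: "(\<lambda>y. det (\<chi> i l. if l = k then axis j 1 $ i else M y $ i $ l) / det (M y)) differentiable (at z)"
    by (rule differentiable_divide[OF differentiable_det det nz])
  \<comment> \<open>The quotient formula describes \<open>matrix_inv\<close> where the determinant
    is nonzero, so this has to hold on a whole ball around z before differentiability can be
    transferred.\<close>
  have "isCont (\<lambda>y. det (M y)) z"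
    using det differentiable_imp_continuous_within by blast
  then have "eventually (\<lambda>y. det (M y) \<noteq> 0) (at z)"
    using nz by (simp add: isCont_def tendsto_imp_eventually_ne)
  then obtain d where "0 < d" "\<And>y. y \<noteq> z \<Longrightarrow> dist y z < d \<Longrightarrow> det (M y) \<noteq> 0"
    unfolding eventually_at by blast
  then have "det (M y) \<noteq> 0" if "dist y z < d" for y
    using nz that by (cases "y = z") auto
  then show "(\<lambda>y. matrix_inv (M y) $ k $ j) differentiable (at z)"
    using differentiable_transform_within[OF * \<open>0 < d\<close>] by (auto simp: matrix_inv_nth)
qed

section \<open>Conjugating the exterior derivative\<close>

lemma differentiable_basis_image:
  fixes e :: "_ \<Rightarrow> 'n + 'n \<Rightarrow> 'n::{finite,linorder} form"
  assumes e: "\<And>a. (\<lambda>y. e y a) differentiable (at z)"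
  shows "(\<lambda>y. basis_image (e y) S) differentiable (at z)"
  by (induction S rule: idx_min_induct) (simp_all add: basis_image_insert_min differentiable_wedge e)

lemma differentiable_alg_hom:
  fixes e :: "_ \<Rightarrow> 'n + 'n \<Rightarrow> 'n::{finite,linorder} form"
  assumes "\<And>a. (\<lambda>y. e y a) differentiable (at z)" "w differentiable (at z)"
  shows "(\<lambda>y. alg_hom (e y) (w y)) differentiable (at z)"
  unfolding alg_hom_def
  by (intro differentiable_sum_fun differentiable_smult differentiable_basis_image differentiable_vec_nth assms)

text \<open>The defining sum is bilinear in coefficients and basis images. The second summand
  freezes w at z, so that it sees only the variation of the frame e.\<close>

lemma wirtinger_alg_hom:
  fixes e :: "_ \<Rightarrow> 'n + 'n \<Rightarrow> 'n::{finite,linorder} form"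
  assumes e: "\<And>a. (\<lambda>y. e y a) differentiable (at z)" and w: "w differentiable (at z)"
  shows "wirtinger a (\<lambda>y. alg_hom (e y) (w y)) z =
    alg_hom (e z) (wirtinger a w z) + wirtinger a (\<lambda>y. alg_hom (e y) (w z)) z"
proof -
  note diff = differentiable_smult differentiable_basis_image[where e = e, OF e] differentiable_vec_nth w
  show ?thesis
    unfolding alg_hom_def
    by (simp add: wirtinger_sum wirtinger_smult diff wirtinger_nth[OF w] sum.distrib)
qed

lemma ext_d_add:
  "\<alpha> differentiable (at z) \<Longrightarrow> \<beta> differentiable (at z) \<Longrightarrow>
    ext_d (\<lambda>y. \<alpha> y + \<beta> y) z = ext_d \<alpha> z + ext_d \<beta> z"
  by (simp add: ext_d_sum wirtinger_add wedge_linear sum.distrib)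

lemma ext_d_smult: "\<alpha> differentiable (at z) \<Longrightarrow> ext_d (\<lambda>y. c *s \<alpha> y) z = c *s ext_d \<alpha> z"
  using wirtinger_smult[where f = "\<lambda>_. c" and z = z] by (simp add: ext_d_sum wedge_linear vec.scale_sum_right)

lemma ext_d_const [simp]: "ext_d (\<lambda>_. \<beta>) z = 0"
  by (simp add: ext_d_sum)

lemma ext_d_covector_wedge:
  assumes "\<eta> differentiable (at z)" "\<alpha> differentiable (at z)" "\<eta> z \<in> covectors"
  shows "ext_d (\<lambda>y. \<eta> y \<^bold>\<and> \<alpha> y) z = ext_d \<eta> z \<^bold>\<and> \<alpha> z - \<eta> z \<^bold>\<and> ext_d \<alpha> z"
  by (simp add: ext_d_sum wirtinger_wedge assms wedge_linear wedge_assoc sum.distrib sum_subtractf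
      covector_left_anticommute[OF dx_covector assms(3)])

text \<open>With a constant argument both sides obey the Leibniz rule of an odd derivation along the
  homomorphism and vanish on the unit, so \<open>EL\<close> on covectors decides.\<close>

lemma ext_d_alg_hom_const:
  fixes e :: "_ \<Rightarrow> 'n + 'n \<Rightarrow> 'n::{finite,linorder} form"
  assumes diff: "\<And>a. (\<lambda>y. e y a) differentiable (at z)" and e: "\<And>y a. e y a \<in> covectors"
    and L: "\<And>a b. L $ b \<^bold>\<and> dx a = dx a \<^bold>\<and> L $ b"
    and EL: "\<And>a. alg_hom (e z) (L $ a) = ext_d (\<lambda>y. e y a) z"
  shows "ext_d (\<lambda>y. alg_hom (e y) \<beta>) z = alg_hom (e z) (L \<rightharpoondown> \<beta>)"
proof -
  have d: "(\<lambda>y. alg_hom (e y) \<gamma>) differentiable (at z)" for \<gamma>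
    by (rule differentiable_alg_hom) (simp_all add: diff)
  show ?thesis
  proof (rule linear_form_eqI[where \<alpha> = \<beta>])
    fix a \<beta> assume "ext_d (\<lambda>y. alg_hom (e y) \<beta>) z = alg_hom (e z) (L \<rightharpoondown> \<beta>)"
    then show "ext_d (\<lambda>y. alg_hom (e y) (dx a \<^bold>\<and> \<beta>)) z = alg_hom (e z) (L \<rightharpoondown> (dx a \<^bold>\<and> \<beta>))"
      by (simp add: alg_hom_dx_wedge[OF e] contr_dx_wedge_even[OF L] ext_d_covector_wedge diff d e
          alg_hom_diff alg_hom_wedge[OF e] alg_hom_dx[OF e] EL)
  qed (simp_all add: alg_hom_add alg_hom_smult ext_d_add ext_d_smult d contr_add_right contr_smult_right)
qed

text \<open>The candidates \<theta> and L enter through their images under the homomorphism, which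
  replaces any computation of its inverse. The sum comes from differentiating the coefficients, the
  contraction from differentiating the frame.\<close>

lemma ext_d_alg_hom:
  fixes e :: "_ \<Rightarrow> 'n + 'n \<Rightarrow> 'n::{finite,linorder} form"
  assumes diff: "\<And>a. (\<lambda>y. e y a) differentiable (at z)" and e: "\<And>y a. e y a \<in> covectors"
    and w: "w differentiable (at z)"
    and L: "\<And>a b. L $ b \<^bold>\<and> dx a = dx a \<^bold>\<and> L $ b"
    and EL: "\<And>a. alg_hom (e z) (L $ a) = ext_d (\<lambda>y. e y a) z"
    and E\<theta>: "\<And>a. alg_hom (e z) (\<theta> a) = dx a"
  shows "ext_d (\<lambda>y. alg_hom (e y) (w y)) z =
    alg_hom (e z) ((\<Sum>a\<in>UNIV. \<theta> a \<^bold>\<and> wirtinger a w z) + L \<rightharpoondown> w z)"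
proof -
  have "ext_d (\<lambda>y. alg_hom (e y) (w y)) z =
      (\<Sum>a\<in>UNIV. dx a \<^bold>\<and> alg_hom (e z) (wirtinger a w z)) + ext_d (\<lambda>y. alg_hom (e y) (w z)) z"
    unfolding ext_d_sum wirtinger_alg_hom[where e = e and w = w, OF diff w]
    by (simp add: wedge_linear sum.distrib)
  then show ?thesis
    using ext_d_alg_hom_const[where e = e, OF diff e L EL]
    by (simp add: alg_hom_add alg_hom_sum alg_hom_wedge[OF e] E\<theta>)
qed

section \<open>The zeroth-order part\<close>

lemma alg_hom_row_form:
  assumes e: "\<And>a. e a \<in> covectors" and "\<And>i. e (s i) = dx (s i) + row_form t (M $ i)"
  shows "alg_hom e (row_form s (N $ i)) = row_form s (N $ i) + row_form t ((N ** M) $ i)"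
proof -
  have "alg_hom e (row_form s (N $ i)) = (\<Sum>l\<in>UNIV. N $ i $ l *s e (s l))"
    by (simp add: row_form_def alg_hom_sum alg_hom_smult alg_hom_dx[OF e])
  also have "\<dots> = row_form s (N $ i) + row_form t ((N ** M) $ i)"
    unfolding row_form_mult assms(2) row_form_def[of s] by (simp add: vec.scale_right_distrib sum.distrib)
  finally show ?thesis .
qed

text \<open>
  The vector-valued 2-form of the zeroth-order part: the value for \<open>u = Inl\<close> and its conjugate for
  \<open>u = Inr\<close> collect all terms of the formula that do not differentiate \<open>\<omega>\<close>.
\<close>

definition torsion ::
    "('n \<Rightarrow> 'n + 'n) \<Rightarrow> ('n \<Rightarrow> 'n + 'n) \<Rightarrow> ((complex, 'n) vec \<Rightarrow> ((complex, 'n) vec, 'n) vec) \<Rightarrow>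
      ((complex, 'n) vec \<Rightarrow> ((complex, 'n) vec, 'n) vec) \<Rightarrow>
      ((complex, 'n) vec \<Rightarrow> ((complex, 'n) vec, 'n) vec) \<Rightarrow>
      ((complex, 'n) vec \<Rightarrow> ((complex, 'n) vec, 'n) vec) \<Rightarrow>
      (complex, 'n::{finite,linorder}) vec \<Rightarrow> 'n vform" where
  "torsion u v P Q R R' z =
    - vpartial_d u (\<lambda>y. map_form u u (P y ** Q y ** R y)) z
    + (vpartial_d u (\<lambda>y. map_form v u (Q y ** R y)) z \<rightharpoondown>\<^sub>v map_form u v (P z))
    + vpartial_d u (\<lambda>y. map_form u v (P y ** R' y)) z
    - (vpartial_d u (\<lambda>y. map_form v v (R' y)) z \<rightharpoondown>\<^sub>v map_form u v (P z))"

text \<open>Contracting into \<open>row_form v (P $ i)\<close> replaces each \<open>dx (v l)\<close>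
  by the l-th component of the differentiated form; P thus ends up as an undifferentiated left
  factor.\<close>

lemma vcontr_vpartial_d_map_form:
  assumes "inj u" "inj v" "mat_differentiable M z"
  shows "(vpartial_d u (\<lambda>y. map_form v s (M y)) z \<rightharpoondown>\<^sub>v map_form u v P) $ u i =
    (\<Sum>j\<in>UNIV. dx (u j) \<^bold>\<and> row_form s ((P ** wirt_mat (u j) M z) $ i))"
  using assms
  by (simp add: vcontr_def map_form_nth contr_row_form vpartial_d_map_form row_form_mult wedge_linear
      vec.scale_sum_right) (rule sum.swap)

lemma matrix_diff_ldistrib: "A ** (B - C) = A ** B - A ** C"
  for A :: "((complex, 'n::finite) vec, 'm::finite) vec"
  by (simp add: matrix_matrix_mult_def vec_eq_iff right_diff_distrib sum_subtractf)

text \<open>The product rule makes the contracted terms cancel every derivative of Q, R and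
  R'.\<close>

lemma torsion_nth:
  fixes u v :: "'n::{finite,linorder} \<Rightarrow> 'n + 'n"
  assumes uv: "inj u" "inj v"
    and diff: "mat_differentiable P z" "mat_differentiable Q z" "mat_differentiable R z" "mat_differentiable R' z"
  shows "torsion u v P Q R R' z $ u i = (\<Sum>j\<in>UNIV. dx (u j) \<^bold>\<and>
    (row_form v ((wirt_mat (u j) P z ** R' z) $ i) - row_form u ((wirt_mat (u j) P z ** (Q z ** R z)) $ i)))"
proof -
  have "torsion u v P Q R R' z $ u i =
    (\<Sum>j\<in>UNIV. dx (u j) \<^bold>\<and>
      (- row_form u (wirt_mat (u j) (\<lambda>y. P y ** (Q y ** R y)) z $ i)
       + row_form u ((P z ** wirt_mat (u j) (\<lambda>y. Q y ** R y) z) $ i)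
       + row_form v (wirt_mat (u j) (\<lambda>y. P y ** R' y) z $ i)
       - row_form v ((P z ** wirt_mat (u j) R' z) $ i)))"
    using uv diff
    by (simp add: torsion_def vpartial_d_map_form[OF uv(1)] vcontr_vpartial_d_map_form[OF uv] mat_differentiable_mult
        matrix_mul_assoc[symmetric] wedge_linear sum.distrib sum_subtractf sum_negf)
  also have "\<dots> = (\<Sum>j\<in>UNIV. dx (u j) \<^bold>\<and>
    (row_form v ((wirt_mat (u j) P z ** R' z) $ i) - row_form u ((wirt_mat (u j) P z ** (Q z ** R z)) $ i)))"
    using diff
    by (intro sum.cong refl arg_cong[where f = "\<lambda>x. _ \<^bold>\<and> x"])
      (simp only: wirt_mat_mult[OF _ mat_differentiable_mult] wirt_mat_mult[of P z R'], simp add: row_form_add)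
  finally show ?thesis .
qed

lemma torsion_nth_other:
  assumes "a \<notin> range u"
  shows "torsion u v P Q R R' z $ a = 0"
  using assms by (simp add: torsion_def vpartial_d_map_form_other vcontr_def map_form_nth_other)

text \<open>The Maurer--Cartan equation in a form that is symmetric under conjugation.\<close>

definition maurer_cartan ::
    "('n \<Rightarrow> 'n + 'n) \<Rightarrow> ('n \<Rightarrow> 'n + 'n) \<Rightarrow> ((complex, 'n) vec \<Rightarrow> ((complex, 'n) vec, 'n) vec) \<Rightarrow>
      (complex, 'n::{finite,linorder}) vec \<Rightarrow> bool" where
  "maurer_cartan u v P z \<longleftrightarrow> (\<forall>i. partial_d v (\<lambda>y. row_form v (P y $ i)) z =
    (\<Sum>j\<in>UNIV. row_form v (P z $ j) \<^bold>\<and> row_form v (wirt_mat (u j) P z $ i)))"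

lemma alg_hom_torsion:
  fixes u v :: "'n::{finite,linorder} \<Rightarrow> 'n + 'n"
  assumes uv: "inj u" "inj v"
    and ext: "\<And>\<alpha> z. ext_d \<alpha> z = partial_d u \<alpha> z + partial_d v \<alpha> z"
    and diff: "mat_differentiable P z" "mat_differentiable Q z" "mat_differentiable R z" "mat_differentiable R' z"
    and R': "R' z ** Q z = Q z ** R z" "R' z ** (mat 1 - Q z ** P z) = mat 1"
    and e: "\<And>a. e a \<in> covectors"
    and eu: "\<And>i. e (u i) = dx (u i) + row_form v (P z $ i)"
    and ev: "\<And>i. e (v i) = dx (v i) + row_form u (Q z $ i)"
    and MC: "maurer_cartan u v P z"
  shows "alg_hom e (torsion u v P Q R R' z $ u i) = ext_d (\<lambda>y. dx (u i) + row_form v (P y $ i)) z"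
proof -
  \<comment> \<open>For any D, the pair (-DQR, DR') is D times the second block row of the inverse
    matrix, so the homomorphism sends it to D in the v-block alone.\<close>
  have "alg_hom e (row_form v ((D ** R' z) $ i) - row_form u ((D ** (Q z ** R z)) $ i)) = row_form v (D $ i)"
    (is "?l = _") for D
  proof -
    have "?l = row_form v ((D ** R' z - D ** (Q z ** R z) ** P z) $ i)
        + row_form u ((D ** R' z ** Q z - D ** (Q z ** R z)) $ i)"
      by (simp add: alg_hom_diff alg_hom_row_form[OF e eu] alg_hom_row_form[OF e ev] row_form_diff)
    also have "D ** R' z ** Q z = D ** (Q z ** R z)"
      by (simp add: matrix_mul_assoc[symmetric] R')
    also have "D ** R' z - D ** (Q z ** R z) ** P z = D ** (R' z ** (mat 1 - Q z ** P z))"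
      by (simp add: matrix_mul_assoc matrix_diff_ldistrib R'(1)[symmetric])
    finally show ?thesis by (simp add: R' row_form_def)
  qed
  then have "alg_hom e (torsion u v P Q R R' z $ u i) =
      (\<Sum>j\<in>UNIV. e (u j) \<^bold>\<and> row_form v (wirt_mat (u j) P z $ i))"
    by (simp add: torsion_nth[OF uv diff] alg_hom_sum alg_hom_dx_wedge[OF e])
  \<comment> \<open>The summand \<open>dx (u j)\<close> of \<open>e (u j)\<close> gives
    \<open>partial_d u\<close>; the other one gives the right side of \<open>maurer_cartan\<close>,
    that is, \<open>partial_d v\<close>.\<close>
  also have "\<dots> = partial_d u (\<lambda>y. row_form v (P y $ i)) z + partial_d v (\<lambda>y. row_form v (P y $ i)) z"
    using MC by (simp add: maurer_cartan_def eu wedge_linear sum.distrib partial_d_def wirtinger_row_form diff)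
  also have "\<dots> = ext_d (\<lambda>y. dx (u i) + row_form v (P y $ i)) z"
    using ext_d_add[of "\<lambda>_. dx (u i)" z "\<lambda>y. row_form v (P y $ i)"] differentiable_row_form[OF diff(1)]
    by (simp add: ext)
  finally show ?thesis .
qed

text \<open>Passing a covector through a product of two covectors costs two signs. This is the
  condition under which contraction by the torsion is an odd derivation.\<close>

lemma torsion_commute:
  fixes u v :: "'n::{finite,linorder} \<Rightarrow> 'n + 'n"
  assumes uv: "inj u" "inj v"
    and diff: "mat_differentiable P z" "mat_differentiable Q z" "mat_differentiable R z" "mat_differentiable R' z"
  shows "torsion u v P Q R R' z $ b \<^bold>\<and> dx a = dx a \<^bold>\<and> torsion u v P Q R R' z $ b"
proof (cases "b \<in> range u")
  case True
  have "(\<eta> \<^bold>\<and> \<xi>) \<^bold>\<and> dx a = dx a \<^bold>\<and> (\<eta> \<^bold>\<and> \<xi>)" if "\<eta> \<in> covectors" "\<xi> \<in> covectors" for \<eta> \<xi> :: "'n form"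
    using that covector_anticommute[OF that(2) dx_covector[of a]]
      covector_left_anticommute[OF that(1) dx_covector[of a], of \<xi>]
    by (simp add: wedge_assoc wedge_linear)
  then show ?thesis
    using True by (auto simp: torsion_nth[OF uv diff] wedge_sum_left wedge_sum_right vec.span_diff intro!: sum.cong)
qed (simp add: torsion_nth_other)

text \<open>Meant for A the form of PQR and B that of PR', or their conjugates: the left side then
  groups the terms of the formula in which \<open>partial_d u\<close> meets w, and the sum on the
  right has the coefficients \<theta>.\<close>

lemma twisted_partial_d:
  assumes A: "\<And>b. (\<lambda>y. A y $ b) differentiable (at z)" "\<And>b. A z $ b \<in> covectors"
    and B: "\<And>b. (\<lambda>y. B y $ b) differentiable (at z)" "\<And>b. B z $ b \<in> covectors"
    and w: "w differentiable (at z)"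
  shows "partial_d u w z + A z \<rightharpoondown> partial_d u w z - partial_d u (\<lambda>y. A y \<rightharpoondown> w y) z
      - B z \<rightharpoondown> partial_d u w z + partial_d u (\<lambda>y. B y \<rightharpoondown> w y) z =
    (\<Sum>i\<in>UNIV. (dx (u i) + A z $ u i - B z $ u i) \<^bold>\<and> wirtinger (u i) w z)
      - vpartial_d u A z \<rightharpoondown> w z + vpartial_d u B z \<rightharpoondown> w z"
    (is "?l = ?r")
proof -
  have "?l = partial_d u w z + (A z \<rightharpoondown> partial_d u w z - partial_d u (\<lambda>y. A y \<rightharpoondown> w y) z)
      - (B z \<rightharpoondown> partial_d u w z - partial_d u (\<lambda>y. B y \<rightharpoondown> w y) z)"
    by simp
  also have "\<dots> = ?r"
    unfolding contr_partial_d_commutator[where K = A, OF A w] contr_partial_d_commutator[where K = B, OF B w]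
    by (simp add: wedge_linear sum.distrib sum_subtractf partial_d_def)
  finally show ?thesis .
qed

section \<open>The Maurer-Cartan equation in coefficients\<close>

definition two_form :: "('n \<Rightarrow> 'n + 'n) \<Rightarrow> ('n \<Rightarrow> 'n \<Rightarrow> complex) \<Rightarrow> 'n::{finite,linorder} form" where
  "two_form v c = (\<Sum>l\<in>UNIV. \<Sum>m\<in>UNIV. c l m *s (dx (v l) \<^bold>\<and> dx (v m)))"

lemma two_form_swap: "two_form v (\<lambda>l m. c m l) = - two_form v c"
proof -
  have "two_form v (\<lambda>l m. c m l) = (\<Sum>l\<in>UNIV. \<Sum>m\<in>UNIV. c l m *s (dx (v m) \<^bold>\<and> dx (v l)))"
    unfolding two_form_def by (rule sum.swap)
  also have "\<dots> = (\<Sum>l\<in>UNIV. \<Sum>m\<in>UNIV. - (c l m *s (dx (v l) \<^bold>\<and> dx (v m))))"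
  proof (intro sum.cong refl)
    fix l m
    show "c l m *s (dx (v m) \<^bold>\<and> dx (v l)) = - (c l m *s (dx (v l) \<^bold>\<and> dx (v m)))"
      using dx_anticommute[of "v m" "v l"] by simp
  qed
  finally show ?thesis by (simp add: two_form_def sum_negf)
qed

text \<open>Products of covectors alternate, so the form knows c only up to antisymmetrization. Two
  interior products recover the antisymmetrized coefficients; conversely, these are the coefficients
  of twice the form.\<close>

lemma two_form_eq_iff:
  fixes v :: "'n::{finite,linorder} \<Rightarrow> 'n + 'n"
  assumes v: "inj v"
  shows "two_form v c = two_form v d \<longleftrightarrow> (\<forall>a b. c a b - c b a = d a b - d b a)"
proof
  have lin: "interior x 0 = 0" "interior x (\<Sum>i\<in>I. f i) = (\<Sum>i\<in>I. interior x (f i))" "interior x (- \<alpha>) = - interior x \<alpha>"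
    for x \<alpha> and f :: "'n \<Rightarrow> 'n form" and I
    using linear_0[OF linear_interior] linear_sum[OF linear_interior] linear_neg[OF linear_interior] by blast+
  have "interior (v b) (interior (v a) (two_form v c)) = (c a b - c b a) *s one_form0" for c a b
  proof -
    have "interior (v b) (interior (v a) (dx (v l) \<^bold>\<and> dx (v m))) =
        (if a = l \<and> b = m then one_form0 else 0) - (if b = l \<and> a = m then one_form0 else 0)" for l m
      by (cases "a = l"; cases "a = m"; cases "b = l"; cases "b = m")
        (simp_all add: interior_dx_wedge interior_dx interior_diff lin inj_eq[OF v])
    then have "interior (v b) (interior (v a) (c l m *s (dx (v l) \<^bold>\<and> dx (v m)))) =
        (if a = l then if b = m then c a b *s one_form0 else 0 else 0)
        - (if b = l then if a = m then c b a *s one_form0 else 0 else 0)" for l m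
      by (auto simp: interior_smult)
    then have "interior (v b) (interior (v a) (two_form v c)) = (\<Sum>l\<in>UNIV. \<Sum>m\<in>UNIV.
        (if a = l then if b = m then c a b *s one_form0 else 0 else 0)
        - (if b = l then if a = m then c b a *s one_form0 else 0 else 0))"
      by (simp only: two_form_def lin(2))
    also have "\<dots> = c a b *s one_form0 - c b a *s one_form0"
    proof -
      have "(\<Sum>m\<in>UNIV. if a = l then if b = m then x else 0 else 0) = (if a = l then x else (0 :: 'n form))"
        for a b l :: 'n and x
        by (cases "a = l") simp_all
      then show ?thesis by (simp add: sum_subtractf)
    qed
    finally show ?thesis by (simp add: vec.scale_left_diff_distrib)
  qed
  moreover assume "two_form v c = two_form v d"
  moreover have "x = y" if "x *s one_form0 = y *s (one_form0 :: 'n form)" for x y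
    using arg_cong[OF that, of "\<lambda>f. f $ {}"] by (simp add: one_form0_def)
  ultimately show "\<forall>a b. c a b - c b a = d a b - d b a" by metis
next
  assume eq: "\<forall>a b. c a b - c b a = d a b - d b a"
  have alt: "two_form v (\<lambda>l m. f l m - f m l) = two_form v f + two_form v f" for f
  proof -
    have "two_form v (\<lambda>l m. f l m - f m l) = two_form v f - two_form v (\<lambda>l m. f m l)"
      by (simp add: two_form_def vec.scale_left_diff_distrib sum_subtractf)
    also have "\<dots> = two_form v f - - two_form v f"
      by (rule arg_cong[OF two_form_swap])
    finally show ?thesis by simp
  qed
  have "two_form v (\<lambda>l m. c l m - c m l) = two_form v (\<lambda>l m. d l m - d m l)"
    using eq by simp
  then have "two_form v c + two_form v c = two_form v d + two_form v d"
    by (simp only: alt)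
  then show "two_form v c = two_form v d" by (simp add: vec_eq_iff)
qed

text \<open>In coefficients the equation consists of scalar identities, to which \<open>cnj\<close>
  can be applied; conjugation of whole forms is thereby avoided.\<close>

lemma maurer_cartan_iff:
  assumes v: "inj v" and P: "mat_differentiable P z"
  shows "maurer_cartan u v P z \<longleftrightarrow> (\<forall>i l m.
    wirt_mat (v l) P z $ i $ m - wirt_mat (v m) P z $ i $ l =
    (\<Sum>j\<in>UNIV. P z $ j $ l * wirt_mat (u j) P z $ i $ m) - (\<Sum>j\<in>UNIV. P z $ j $ m * wirt_mat (u j) P z $ i $ l))"
proof -
  have "partial_d v (\<lambda>y. row_form v (P y $ i)) z = two_form v (\<lambda>l m. wirt_mat (v l) P z $ i $ m)" for i
    by (simp add: partial_d_def wirtinger_row_form[OF P] two_form_def row_form_def[of v "wirt_mat _ _ _ $ _"] wedge_linear)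
  moreover have "(\<Sum>j\<in>UNIV. row_form v (P z $ j) \<^bold>\<and> row_form v (wirt_mat (u j) P z $ i)) =
      two_form v (\<lambda>l m. \<Sum>j\<in>UNIV. P z $ j $ l * wirt_mat (u j) P z $ i $ m)" for i
  proof -
    have "(\<Sum>j\<in>UNIV. row_form v (P z $ j) \<^bold>\<and> row_form v (wirt_mat (u j) P z $ i)) =
      (\<Sum>j\<in>UNIV. \<Sum>l\<in>UNIV. \<Sum>m\<in>UNIV. (P z $ j $ l * wirt_mat (u j) P z $ i $ m) *s (dx (v l) \<^bold>\<and> dx (v m)))"
      unfolding row_form_def wedge_sum_left wedge_sum_right
      by (simp add: wedge_linear mult.commute) (rule sum.cong[OF refl], rule sum.swap)
    also have "\<dots> = (\<Sum>l\<in>UNIV. \<Sum>j\<in>UNIV. \<Sum>m\<in>UNIV. (P z $ j $ l * wirt_mat (u j) P z $ i $ m) *s (dx (v l) \<^bold>\<and> dx (v m)))"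
      by (rule sum.swap)
    also have "\<dots> = two_form v (\<lambda>l m. \<Sum>j\<in>UNIV. P z $ j $ l * wirt_mat (u j) P z $ i $ m)"
      unfolding two_form_def vec.scale_sum_left by (intro sum.cong refl sum.swap)
    finally show ?thesis .
  qed
  ultimately show ?thesis
    unfolding maurer_cartan_def by (simp add: two_form_eq_iff[OF v])
qed

lemma maurer_cartan_cnj:
  assumes "maurer_cartan Inl Inr P z" and P: "mat_differentiable P z"
    and P': "mat_differentiable (\<lambda>y. cnj_mat (P y)) z"
  shows "maurer_cartan Inr Inl (\<lambda>y. cnj_mat (P y)) z"
proof -
  have "wirt_mat (Inl l) (\<lambda>y. cnj_mat (P y)) z = cnj_mat (wirt_mat (Inr l) P z)"
    "wirt_mat (Inr l) (\<lambda>y. cnj_mat (P y)) z = cnj_mat (wirt_mat (Inl l) P z)" for l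
    using P by (simp_all add: wirt_mat_def cnj_mat_def vec_eq_iff wirt_cnj mat_differentiable_def)
  moreover have "cnj (wirt_mat (Inr l) P z $ i $ m - wirt_mat (Inr m) P z $ i $ l) =
    cnj ((\<Sum>j\<in>UNIV. P z $ j $ l * wirt_mat (Inl j) P z $ i $ m) - (\<Sum>j\<in>UNIV. P z $ j $ m * wirt_mat (Inl j) P z $ i $ l))"
    for i l m
    using assms(1) maurer_cartan_iff[OF inj_Inr P, of Inl] by simp
  ultimately show ?thesis
    unfolding maurer_cartan_iff[OF inj_Inl P'] by (simp add: cnj_mat_def)
qed

section \<open>Inverting the block matrix\<close>

lemma matrix_diff_rdistrib: "(A - B) ** C = A ** C - B ** C"
  for A B :: "((complex, 'n::finite) vec, 'm::finite) vec"
  by (simp add: matrix_matrix_mult_def vec_eq_iff left_diff_distrib sum_subtractf)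

text \<open>Multiply B (1 - AB) = (1 - BA) B by the two inverses, one on each side.\<close>

lemma matrix_inv_push_through:
  fixes A B :: "((complex, 'n::finite) vec, 'n) vec"
  assumes "invertible (mat 1 - A ** B)" "invertible (mat 1 - B ** A)"
  shows "matrix_inv (mat 1 - B ** A) ** B = B ** matrix_inv (mat 1 - A ** B)"
proof -
  let ?R = "matrix_inv (mat 1 - A ** B)" and ?R' = "matrix_inv (mat 1 - B ** A)"
  have "?R' ** B = ?R' ** B ** ((mat 1 - A ** B) ** ?R)"
    by (simp add: matrix_inv_inverse assms)
  also have "\<dots> = ?R' ** (B ** (mat 1 - A ** B)) ** ?R"
    by (simp add: matrix_mul_assoc)
  also have "B ** (mat 1 - A ** B) = (mat 1 - B ** A) ** B"
    by (simp add: matrix_diff_ldistrib matrix_diff_rdistrib matrix_mul_assoc)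
  also have "?R' ** ((mat 1 - B ** A) ** B) ** ?R = B ** ?R"
    by (simp add: matrix_mul_assoc matrix_inv_inverse assms)
  finally show ?thesis .
qed

lemma row_form_mat_1: "row_form s (mat 1 $ i) = dx (s i)"
proof -
  have "mat 1 $ i = axis i (1 :: complex)" by (simp add: mat_def axis_def vec_eq_iff)
  then show ?thesis by (simp add: row_form_axis)
qed

text \<open>The argument of the homomorphism is the block row (R, -PR') of the inverse matrix,
  because 1 + PQR = R.\<close>

lemma alg_hom_coframe:
  fixes u v :: "'n::{finite,linorder} \<Rightarrow> 'n + 'n"
  assumes uv: "inj u"
    and R: "(mat 1 - P ** Q) ** R = mat 1" "R ** (mat 1 - P ** Q) = mat 1" "R ** P = P ** R'"
    and e: "\<And>a. e a \<in> covectors"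
    and eu: "\<And>i. e (u i) = dx (u i) + row_form v (P $ i)"
    and ev: "\<And>i. e (v i) = dx (v i) + row_form u (Q $ i)"
  shows "alg_hom e (dx (u i) + map_form u u (P ** Q ** R) $ u i - map_form u v (P ** R') $ u i) = dx (u i)"
proof -
  have "mat 1 + P ** Q ** R = R"
    using R(1) by (simp add: matrix_diff_rdistrib algebra_simps)
  then have "dx (u i) + map_form u u (P ** Q ** R) $ u i = row_form u (R $ i)"
    by (simp add: map_form_nth[OF uv] row_form_mat_1[symmetric] row_form_add[symmetric] vector_add_component[symmetric])
  then have "alg_hom e (dx (u i) + map_form u u (P ** Q ** R) $ u i - map_form u v (P ** R') $ u i) =
      row_form u ((R - P ** R' ** Q) $ i) + row_form v ((R ** P - P ** R') $ i)"
    by (simp add: alg_hom_diff map_form_nth[OF uv] alg_hom_row_form[OF e eu] alg_hom_row_form[OF e ev] row_form_diff)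
  also have "R - P ** R' ** Q = mat 1"
    using R(2) by (simp add: R(3)[symmetric] matrix_diff_ldistrib matrix_mul_assoc)
  finally show ?thesis by (simp add: R(3) row_form_mat_1) (simp add: row_form_def)
qed

section \<open>The formula at a point\<close>

lemma vdel_eq: "vdel = vpartial_d Inl" and vdelbar_eq: "vdelbar = vpartial_d Inr"
  by (simp_all add: fun_eq_iff vdel_def vdelbar_def vpartial_d_def del_eq_partial_d delbar_eq_partial_d)

lemma mat_differentiable_diff:
  "mat_differentiable M z \<Longrightarrow> mat_differentiable N z \<Longrightarrow> mat_differentiable (\<lambda>y. M y - N y) z"
  by (simp add: mat_differentiable_def)

lemma mat_differentiable_cnj_mat:
  "mat_differentiable M z \<Longrightarrow> mat_differentiable (\<lambda>y. cnj_mat (M y)) z"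
  by (simp add: mat_differentiable_def cnj_mat_def linear_differentiable[of cnj] linearI)

text \<open>The geometry enters through facts at the point z: differentiability, invertibility and
  the Maurer-Cartan equation. The terms keep their order in the theorem, so that unfolding suffices
  to apply the result.\<close>

lemma exp_pair_ext_d:
  fixes P :: "(complex, 'n::{finite,linorder}) vec \<Rightarrow> ((complex, 'n) vec, 'n) vec"
  defines "Q \<equiv> \<lambda>y. cnj_mat (P y)"
  defines "R \<equiv> \<lambda>y. matrix_inv (mat 1 - P y ** Q y)" and "R' \<equiv> \<lambda>y. matrix_inv (mat 1 - Q y ** P y)"
  assumes P: "mat_differentiable P z" and w: "w differentiable (at z)"
    and inv: "invertible (mat 1 - P z ** Q z)" "invertible (mat 1 - Q z ** P z)"
    and MC: "maurer_cartan Inl Inr P z"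
  shows "ext_d (\<lambda>y. exp_pair (P y) (w y)) z = exp_pair (P z)
    (partial_d Inl w z + map_form Inl Inl (P z ** Q z ** R z) \<rightharpoondown> partial_d Inl w z
      - partial_d Inl (\<lambda>y. map_form Inl Inl (P y ** Q y ** R y) \<rightharpoondown> w y) z
      + (vpartial_d Inl (\<lambda>y. map_form Inr Inl (Q y ** R y)) z \<rightharpoondown>\<^sub>v map_form Inl Inr (P z)) \<rightharpoondown> w z
     - map_form Inr Inl (Q z ** R z) \<rightharpoondown> partial_d Inr w z
      + partial_d Inr (\<lambda>y. map_form Inr Inl (Q y ** R y) \<rightharpoondown> w y) z
      - (vpartial_d Inr (\<lambda>y. map_form Inl Inl (R y)) z \<rightharpoondown>\<^sub>v map_form Inr Inl (Q z)) \<rightharpoondown> w z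
     + partial_d Inr w z + map_form Inr Inr (Q z ** P z ** R' z) \<rightharpoondown> partial_d Inr w z
      - partial_d Inr (\<lambda>y. map_form Inr Inr (Q y ** P y ** R' y) \<rightharpoondown> w y) z
      + (vpartial_d Inr (\<lambda>y. map_form Inl Inr (P y ** R' y)) z \<rightharpoondown>\<^sub>v map_form Inr Inl (Q z)) \<rightharpoondown> w z
     - map_form Inl Inr (P z ** R' z) \<rightharpoondown> partial_d Inl w z
      + partial_d Inl (\<lambda>y. map_form Inl Inr (P y ** R' y) \<rightharpoondown> w y) z
      - (vpartial_d Inl (\<lambda>y. map_form Inr Inr (R' y)) z \<rightharpoondown>\<^sub>v map_form Inl Inr (P z)) \<rightharpoondown> w z)"
    (is "_ = exp_pair (P z) ?rhs")
proof -
  let ?e = "\<lambda>y. exp_frame (P y)"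
  have Q: "mat_differentiable Q z"
    unfolding Q_def by (rule mat_differentiable_cnj_mat[OF P])
  have one: "mat_differentiable (\<lambda>_. mat 1) z" by (simp add: mat_differentiable_def)
  have R: "mat_differentiable R z" and R': "mat_differentiable R' z"
    unfolding R_def R'_def
    by (intro mat_differentiable_matrix_inv mat_differentiable_diff mat_differentiable_mult one P Q inv)+
  have QR: "R' z ** Q z = Q z ** R z" and PR': "R z ** P z = P z ** R' z"
    unfolding R_def R'_def using matrix_inv_push_through inv by blast+
  have Rinv: "(mat 1 - P z ** Q z) ** R z = mat 1" "R z ** (mat 1 - P z ** Q z) = mat 1"
      "(mat 1 - Q z ** P z) ** R' z = mat 1" "R' z ** (mat 1 - Q z ** P z) = mat 1"
    unfolding R_def R'_def using inv by (simp_all add: matrix_inv_inverse)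
  have e_Inl: "?e y (Inl i) = dx (Inl i) + row_form Inr (P y $ i)"
    and e_Inr: "?e y (Inr i) = dx (Inr i) + row_form Inl (Q y $ i)" for y i
    by (simp_all add: exp_frame_def Q_def)
  have diff: "(\<lambda>y. ?e y a) differentiable (at z)" for a
    using P Q by (cases a) (auto simp: e_Inl e_Inr intro!: differentiable_add differentiable_row_form)
  have MC': "maurer_cartan Inr Inl Q z"
    unfolding Q_def using maurer_cartan_cnj[OF MC P] Q by (simp add: Q_def)
  \<comment> \<open>The two torsion forms live on complementary index ranges, so L agrees with one
    of them on each half.\<close>
  define L where "L = torsion Inl Inr P Q R R' z + torsion Inr Inl Q P R' R z"
  have L_Inl: "L $ Inl i = torsion Inl Inr P Q R R' z $ Inl i"
    and L_Inr: "L $ Inr i = torsion Inr Inl Q P R' R z $ Inr i" for i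
    by (simp_all add: L_def torsion_nth_other image_iff)
  have L: "L $ b \<^bold>\<and> dx a = dx a \<^bold>\<and> L $ b" for a b
    using torsion_commute[of Inl Inr P z Q R R' b a] torsion_commute[of Inr Inl Q z P R' R b a] P Q R R'
    by (cases b) (simp_all only: L_Inl L_Inr inj_Inl inj_Inr)
  have EL: "alg_hom (?e z) (L $ a) = ext_d (\<lambda>y. ?e y a) z" for a
  proof (cases a)
    case (Inl i)
    show ?thesis unfolding Inl L_Inl e_Inl
      by (rule alg_hom_torsion) (simp_all add: ext_d_eq P Q R R' QR Rinv e_Inl e_Inr MC)
  next
    case (Inr i)
    show ?thesis unfolding Inr L_Inr e_Inr
      by (rule alg_hom_torsion) (simp_all add: ext_d_eq P Q R R' PR' Rinv e_Inl e_Inr MC' add.commute)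
  qed
  \<comment> \<open>Read off from the terms that differentiate w: each half is a block row of the
    inverse matrix.\<close>
  define \<theta> where "\<theta> a = (case a of
      Inl i \<Rightarrow> dx (Inl i) + map_form Inl Inl (P z ** Q z ** R z) $ Inl i - map_form Inl Inr (P z ** R' z) $ Inl i
    | Inr i \<Rightarrow> dx (Inr i) + map_form Inr Inr (Q z ** P z ** R' z) $ Inr i - map_form Inr Inl (Q z ** R z) $ Inr i)" for a
  have E\<theta>: "alg_hom (?e z) (\<theta> a) = dx a" for a
  proof (cases a)
    case (Inl i)
    show ?thesis unfolding Inl \<theta>_def sum.case
      by (rule alg_hom_coframe) (simp_all add: PR' Rinv e_Inl e_Inr)
  next
    case (Inr i)
    show ?thesis unfolding Inr \<theta>_def sum.case
      by (rule alg_hom_coframe) (simp_all add: QR Rinv e_Inl e_Inr)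
  qed
  note diff_map = differentiable_map_form mat_differentiable_mult P Q R R'
  have "ext_d (\<lambda>y. exp_pair (P y) (w y)) z =
      exp_pair (P z) ((\<Sum>a\<in>UNIV. \<theta> a \<^bold>\<and> wirtinger a w z) + L \<rightharpoondown> w z)"
    unfolding exp_pair_eq_alg_hom
    by (rule ext_d_alg_hom[where e = ?e, OF diff exp_frame_covector w L EL E\<theta>])
  also have "(\<Sum>a\<in>UNIV. \<theta> a \<^bold>\<and> wirtinger a w z) + L \<rightharpoondown> w z = ?rhs"
  proof -
    \<comment> \<open>\<open>twisted_partial_d\<close> has the sum over \<theta> on its right side;
      isolating it lets it be rewritten by the operators, after which the terms match by additive
      cancellation.\<close>
    have solve: "y = x + a - b" if "x = y - a + b" for x y a b :: "'n form"
      using that by simp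
    have Inl: "partial_d Inl w z + map_form Inl Inl (P z ** Q z ** R z) \<rightharpoondown> partial_d Inl w z
        - partial_d Inl (\<lambda>y. map_form Inl Inl (P y ** Q y ** R y) \<rightharpoondown> w y) z
        - map_form Inl Inr (P z ** R' z) \<rightharpoondown> partial_d Inl w z
        + partial_d Inl (\<lambda>y. map_form Inl Inr (P y ** R' y) \<rightharpoondown> w y) z =
      (\<Sum>i\<in>UNIV. \<theta> (Inl i) \<^bold>\<and> wirtinger (Inl i) w z)
        - vpartial_d Inl (\<lambda>y. map_form Inl Inl (P y ** Q y ** R y)) z \<rightharpoondown> w z
        + vpartial_d Inl (\<lambda>y. map_form Inl Inr (P y ** R' y)) z \<rightharpoondown> w z"
      unfolding \<theta>_def sum.case by (rule twisted_partial_d) (simp_all add: diff_map w)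
    have Inr: "partial_d Inr w z + map_form Inr Inr (Q z ** P z ** R' z) \<rightharpoondown> partial_d Inr w z
        - partial_d Inr (\<lambda>y. map_form Inr Inr (Q y ** P y ** R' y) \<rightharpoondown> w y) z
        - map_form Inr Inl (Q z ** R z) \<rightharpoondown> partial_d Inr w z
        + partial_d Inr (\<lambda>y. map_form Inr Inl (Q y ** R y) \<rightharpoondown> w y) z =
      (\<Sum>i\<in>UNIV. \<theta> (Inr i) \<^bold>\<and> wirtinger (Inr i) w z)
        - vpartial_d Inr (\<lambda>y. map_form Inr Inr (Q y ** P y ** R' y)) z \<rightharpoondown> w z
        + vpartial_d Inr (\<lambda>y. map_form Inr Inl (Q y ** R y)) z \<rightharpoondown> w z"
      unfolding \<theta>_def sum.case by (rule twisted_partial_d) (simp_all add: diff_map w)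
    show ?thesis
      unfolding sum_UNIV_sum solve[OF Inl] solve[OF Inr] L_def torsion_def
        contr_add_left contr_diff_left contr_minus_left
      by simp
  qed
  finally show ?thesis .
qed

section \<open>Passage from charts to a point\<close>

lemma smooth_on_differentiable:
  assumes "smooth_on S f" "z \<in> S"
  shows "f differentiable (at z)"
proof -
  have "Ck_on (Suc 0) S f" using assms(1) unfolding smooth_on_def by blast
  then show ?thesis using assms(2) unfolding differentiable_def by auto
qed

text \<open>Both halves of each summand in \<open>bracket\<close> coincide when its arguments do,
  and the factor 1/2 removes the resulting 2.\<close>

lemma maurer_cartan_phi_form:
  assumes P: "mat_differentiable P z"
    and eq: "vdelbar (\<lambda>y. phi_form (P y)) z = (1 / 2) *\<^sub>R bracket (\<lambda>y. phi_form (P y)) (\<lambda>y. phi_form (P y)) z"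
  shows "maurer_cartan Inl Inr P z"
  unfolding maurer_cartan_def
proof
  fix i
  have "partial_d Inr (\<lambda>y. row_form Inr (P y $ i)) z = vdelbar (\<lambda>y. phi_form (P y)) z $ Inl i"
    by (simp add: vdelbar_eq vpartial_d_def phi_form_def map_form_nth)
  also have "\<dots> = (\<Sum>j\<in>UNIV. row_form Inr (P z $ j) \<^bold>\<and> row_form Inr (wirt_mat (Inl j) P z $ i))"
    unfolding eq
    by (simp add: bracket_def phi_form_def map_form_nth wirtinger_row_form[OF P] sum.distrib
        scaleR_2[symmetric] scaleR_sum_right[symmetric] del: wirtinger.simps)
  finally show "partial_d Inr (\<lambda>y. row_form Inr (P y $ i)) z =
    (\<Sum>j\<in>UNIV. row_form Inr (P z $ j) \<^bold>\<and> row_form Inr (wirt_mat (Inl j) P z $ i))" .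
qed

theorem proposition1p12:
  fixes X :: "'a::{t2_space,second_countable_topology} set"
    and A :: "('a, 'n::{finite,linorder} option) chart set"
    and \<pi> :: "'a \<Rightarrow> complex" and r :: real
    and \<sigma> :: "'a \<Rightarrow> 'a" and G :: "'a \<Rightarrow> complex \<Rightarrow> 'a"
    and \<phi> :: "complex \<Rightarrow> ('a, 'n) chart \<Rightarrow> (complex, 'n) vec \<Rightarrow> ((complex, 'n) vec, 'n) vec"
    and \<omega> :: "('a, 'n) chart \<Rightarrow> (complex, 'n) vec \<Rightarrow> 'n form"
    and t :: complex and p q :: nat
  assumes "holomorphic_family X A \<pi> r"
    and "transversely_holomorphic_trivialization X A \<pi> r \<sigma> G"
    and "kuranishi_data X A \<pi> r G \<phi>"
    and "t \<in> ball 0 r"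
    and "\<forall>(U, c)\<in>fiber_atlas X A \<pi> 0. \<forall>z\<in>c ` U.
           invertible (mat 1 - \<phi> t (U, c) z ** cnj_mat (\<phi> t (U, c) z)) \<and>
           invertible (mat 1 - cnj_mat (\<phi> t (U, c) z) ** \<phi> t (U, c) z)"
    and "pq_form (fiber_atlas X A \<pi> 0) p q \<omega>"
  shows "\<forall>(U, c)\<in>fiber_atlas X A \<pi> 0. \<forall>z\<in>c ` U.
    (let w = \<omega> (U, c);
         P = \<phi> t (U, c);
         Q = (\<lambda>y. cnj_mat (P y));
         R = (\<lambda>y. matrix_inv (mat 1 - P y ** Q y));
         R' = (\<lambda>y. matrix_inv (mat 1 - Q y ** P y));
         phi = (\<lambda>y. phi_form (P y));
         phibar = (\<lambda>y. phibar_form (P y));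
         phi_phibar_R = (\<lambda>y. map_form Inl Inl (P y ** Q y ** R y));
         phibar_R = (\<lambda>y. map_form Inr Inl (Q y ** R y));
         inv_R = (\<lambda>y. map_form Inl Inl (R y));
         phibar_phi_R' = (\<lambda>y. map_form Inr Inr (Q y ** P y ** R' y));
         phi_R' = (\<lambda>y. map_form Inl Inr (P y ** R' y));
         inv_R' = (\<lambda>y. map_form Inr Inr (R' y))
     in ext_d (\<lambda>y. exp_pair (P y) (w y)) z =
        exp_pair (P z)
         (del w z + phi_phibar_R z \<rightharpoondown> del w z - del (\<lambda>y. phi_phibar_R y \<rightharpoondown> w y) z
            + (vdel phibar_R z \<rightharpoondown>\<^sub>v phi z) \<rightharpoondown> w z
          - phibar_R z \<rightharpoondown> delbar w z + delbar (\<lambda>y. phibar_R y \<rightharpoondown> w y) z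
            - (vdelbar inv_R z \<rightharpoondown>\<^sub>v phibar z) \<rightharpoondown> w z
          + delbar w z + phibar_phi_R' z \<rightharpoondown> delbar w z - delbar (\<lambda>y. phibar_phi_R' y \<rightharpoondown> w y) z
            + (vdelbar phi_R' z \<rightharpoondown>\<^sub>v phibar z) \<rightharpoondown> w z
          - phi_R' z \<rightharpoondown> del w z + del (\<lambda>y. phi_R' y \<rightharpoondown> w y) z
            - (vdel inv_R' z \<rightharpoondown>\<^sub>v phi z) \<rightharpoondown> w z))"
proof (clarify, goal_cases)
  \<comment> \<open>All operators act inside one chart, so the chart and a point of its image are
    fixed; the point is given by its preimage x.\<close>
  case (1 U c _ x)
  let ?z = "c x" and ?P = "\<phi> t (U, c)" and ?w = "\<omega> (U, c)"
  have z: "?z \<in> c ` U" using 1 by blast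
  note kuranishi = assms(3)[unfolded kuranishi_data_def]
  have beltrami: "beltrami_field (fiber_atlas X A \<pi> 0) (\<phi> t)"
    using kuranishi[THEN conjunct1] assms(4) by (rule bspec)
  have "smooth_on (c ` U) ?P"
    using bspec[OF conjunct1[OF beltrami[unfolded beltrami_field_def]] 1(1)] by simp
  then have P: "mat_differentiable ?P ?z"
    unfolding mat_differentiable_def by (intro allI differentiable_vec_nth smooth_on_differentiable[OF _ z])
  have "smooth_on (c ` U) ?w"
    using bspec[OF conjunct1[OF assms(6)[unfolded pq_form_def]] 1(1)] by simp
  then have w: "?w differentiable (at ?z)" by (rule smooth_on_differentiable[OF _ z])
  have inv: "invertible (mat 1 - ?P ?z ** cnj_mat (?P ?z))" "invertible (mat 1 - cnj_mat (?P ?z) ** ?P ?z)"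
    using bspec[OF assms(5) 1(1)] z by auto
  have "vdelbar (\<lambda>y. phi_form (?P y)) ?z =
      (1 / 2) *\<^sub>R bracket (\<lambda>y. phi_form (?P y)) (\<lambda>y. phi_form (?P y)) ?z"
    using bspec[OF bspec[OF kuranishi[THEN conjunct2, THEN conjunct2, THEN conjunct1] assms(4)] 1(1), unfolded prod.case] z
    by (rule bspec)
  then have MC: "maurer_cartan Inl Inr ?P ?z" by (rule maurer_cartan_phi_form[OF P])
  \<comment> \<open>With the Dolbeault operators written as \<open>partial_d\<close> and
    \<open>vpartial_d\<close>, the claim in the fixed chart is the pointwise formula.\<close>
  show ?case
    unfolding Let_def phi_form_def phibar_form_def del_eq_partial_d delbar_eq_partial_d vdel_eq vdelbar_eq
    by (rule exp_pair_ext_d[OF P w inv MC])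
qed

end
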